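(* Let $\mathrm{g}\ge1$ and let $\mathcal{V}$ be the affine space, of dimension $3\mathrm{g}+2$, of matrices $\mathcal{L}(\zeta)=\begin{pmatrix}\mathrm{P}(\zeta)&\mathrm{R}(\zeta)\\ \mathrm{Q}(\zeta)&-\mathrm{P}(\zeta)\end{pmatrix}$ with $\mathrm{P}$ monic of degree $\mathrm{g}+1$, $\mathrm{R}$ monic of degree $\mathrm{g}$, and $\mathrm{Q}$ of degree at most $\mathrm{g}$ (coordinates: the non-fixed coefficients), equipped with the bracket $\{\mathrm{P}(\zeta),\mathrm{P}(\eta)\}=0=\{\mathrm{R}(\zeta),\mathrm{R}(\eta)\}$, $\{\mathrm{P}(\zeta),\mathrm{Q}(\eta)\}=2\frac{\mathrm{Q}(\zeta)-\mathrm{Q}(\eta)}{\zeta-\eta}$, $\{\mathrm{P}(\zeta),\mathrm{R}(\eta)\}=-2\frac{\mathrm{R}(\zeta)-\mathrm{R}(\eta)}{\zeta-\eta}$, $\{\mathrm{Q}(\zeta),\mathrm{Q}(\eta)\}=-4(\mathrm{Q}(\zeta)-\mathrm{Q}(\eta))$, $\{\mathrm{Q}(\zeta),\mathrm{R}(\eta)\}=4\frac{\mathrm{P}(\zeta)-\mathrm{P}(\eta)}{\zeta-\eta}-4\mathrm{R}(\eta)$. Write $F(\zeta)=-\det\mathcal{L}(\zeta)=\mathrm{P}(\zeta)^2+\mathrm{Q}(\zeta)\mathrm{R}(\zeta)=\zeta^{2\mathrm{g}+2}+\sum_{j=0}^{2\mathrm{g}+1}c_j\zeta^j$ and $H_j=c_j$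 for $j=0,\dots,\mathrm{g}-1$. Then the Hamiltonians $H_0,\dots,H_{\mathrm{g}-1}$ define a completely integrable system on $\mathcal{V}$.
   Context: The bracket relations are generating-function identities in two independent variables $\zeta,\eta$: expanding both sides in powers of $\zeta,\eta$ gives the Poisson brackets between all coefficients of $\mathrm{P},\mathrm{Q},\mathrm{R}$ (the brackets are linear in these coefficients), extended to all polynomial functions by the Leibniz rule. Completely integrable (Liouville sense) means: the bracket is a Poisson bracket, the $H_j$ are pairwise in involution, and on the (generic) symplectic leaves, whose dimension is twice the number $\mathrm{g}$ of the $H_j$, these functions are functionally independent. *)

theory Defs
  imports
    "HOL-Analysis.Analysis"
    "HOL-Library.Function_Algebras"
    "HOL-Computational_Algebra.Polynomial"
begin

section \<open>Polynomial Poisson structures on a complex affine space\<close>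

text \<open>
  The affine space with finite coordinate set \<open>I\<close> is the set of functions \<open>'i \<Rightarrow> complex\<close> vanishing
  outside \<open>I\<close>; its subspace topology (from the product topology) is the usual topology of
  \<open>\<complex>\<close>-valued coordinate tuples. Sums and products of functions are taken pointwise.
\<close>

definition affine_space :: "'i set \<Rightarrow> ('i \<Rightarrow> complex) set" where
  "affine_space I = {x. \<forall>i. i \<notin> I \<longrightarrow> x i = 0}"

text \<open>
  Polynomial functions are represented on the whole type, but depend on the coordinates in \<open>I\<close>
  only, so that they are determined by their restriction to \<open>affine_space I\<close>.
\<close>

inductive_set polynomial_functions :: "'i set \<Rightarrow> (('i \<Rightarrow> complex) \<Rightarrow> complex) set"
  for I :: "'i set" where
  const: "(\<lambda>_. c) \<in> polynomial_functions I"
| coord: "i \<in> I \<Longrightarrow> (\<lambda>x. x i) \<in> polynomial_functions I"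
| add: "f \<in> polynomial_functions I \<Longrightarrow> h \<in> polynomial_functions I \<Longrightarrow> f + h \<in> polynomial_functions I"
| mult: "f \<in> polynomial_functions I \<Longrightarrow> h \<in> polynomial_functions I \<Longrightarrow> f * h \<in> polynomial_functions I"

type_synonym 'i bracket =
  "(('i \<Rightarrow> complex) \<Rightarrow> complex) \<Rightarrow> (('i \<Rightarrow> complex) \<Rightarrow> complex) \<Rightarrow> ('i \<Rightarrow> complex) \<Rightarrow> complex"

text \<open>
  Linearity and the Leibniz rule in the second argument follow from skew-symmetry.
\<close>

definition skew_biderivation :: "'i set \<Rightarrow> 'i bracket \<Rightarrow> bool" where
  "skew_biderivation I br \<longleftrightarrow>
     (\<forall>f \<in> polynomial_functions I. \<forall>h \<in> polynomial_functions I.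
        br f h \<in> polynomial_functions I \<and> br f h = - br h f) \<and>
     (\<forall>f \<in> polynomial_functions I. \<forall>f' \<in> polynomial_functions I. \<forall>h \<in> polynomial_functions I.
        br (f + f') h = br f h + br f' h \<and>
        br (f * f') h = f * br f' h + f' * br f h) \<and>
     (\<forall>c. \<forall>f \<in> polynomial_functions I. \<forall>h \<in> polynomial_functions I.
        br ((\<lambda>_. c) * f) h = (\<lambda>_. c) * br f h)"

definition poisson_bracket :: "'i set \<Rightarrow> 'i bracket \<Rightarrow> bool" where
  "poisson_bracket I br \<longleftrightarrow>
     skew_biderivation I br \<and>
     (\<forall>f \<in> polynomial_functions I. \<forall>h \<in> polynomial_functions I. \<forall>k \<in> polynomial_functions I.
        br (br f h) k + br (br h k) f + br (br k f) h = 0)"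

definition hamiltonian_field ::
  "'i set \<Rightarrow> 'i bracket \<Rightarrow> (('i \<Rightarrow> complex) \<Rightarrow> complex) \<Rightarrow> ('i \<Rightarrow> complex) \<Rightarrow> 'i \<Rightarrow> complex" where
  "hamiltonian_field I br f x = (\<lambda>i. if i \<in> I then br (\<lambda>z. z i) f x else 0)"

text \<open>
  The symplectic leaf through \<open>x\<close> consists of the points that can be reached from \<open>x\<close> along
  finitely many successive integral curves of Hamiltonian vector fields. Real time and unit
  duration suffice, since \<open>f\<close> may be multiplied by any complex constant; polynomial Hamiltonians
  suffice, since their differentials span every cotangent space.
\<close>

definition hamiltonian_step :: "'i set \<Rightarrow> 'i bracket \<Rightarrow> (('i \<Rightarrow> complex) \<times> ('i \<Rightarrow> complex)) set" where
  "hamiltonian_step I br =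
     {(x, y). \<exists>f \<in> polynomial_functions I. \<exists>\<gamma> :: real \<Rightarrow> 'i \<Rightarrow> complex.
        \<gamma> 0 = x \<and> \<gamma> 1 = y \<and>
        (\<forall>t \<in> {0..1}. \<gamma> t \<in> affine_space I \<and>
           (\<forall>i. ((\<lambda>s. \<gamma> s i) has_vector_derivative hamiltonian_field I br f (\<gamma> t) i)
                  (at t within {0..1})))}"

definition symplectic_leaf :: "'i set \<Rightarrow> 'i bracket \<Rightarrow> ('i \<Rightarrow> complex) \<Rightarrow> ('i \<Rightarrow> complex) set" where
  "symplectic_leaf I br x = (hamiltonian_step I br)\<^sup>* `` {x}"

text \<open>
  Tangent vectors of an immersed leaf \<open>S\<close> are the velocities of the continuously differentiable
  curves running inside \<open>S\<close>. (Leaves are weakly embedded, so these curves are also continuously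
  differentiable as curves in the leaf.)
\<close>

definition tangent_vectors :: "('i \<Rightarrow> complex) set \<Rightarrow> ('i \<Rightarrow> complex) \<Rightarrow> ('i \<Rightarrow> complex) set" where
  "tangent_vectors S y =
     {v. \<exists>\<gamma> \<gamma>' :: real \<Rightarrow> 'i \<Rightarrow> complex.
        \<gamma> 0 = y \<and> \<gamma>' 0 = v \<and>
        (\<forall>t \<in> {-1<..<1}. \<gamma> t \<in> S) \<and>
        (\<forall>i. continuous_on {-1<..<1} (\<lambda>t. \<gamma>' t i)) \<and>
        (\<forall>i. \<forall>t \<in> {-1<..<1}. ((\<lambda>s. \<gamma> s i) has_vector_derivative \<gamma>' t i) (at t))}"

definition cscale :: "complex \<Rightarrow> ('i \<Rightarrow> complex) \<Rightarrow> 'i \<Rightarrow> complex" where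
  "cscale c v = (\<lambda>i. c * v i)"

global_interpretation cfun: vector_space "cscale :: complex \<Rightarrow> ('i \<Rightarrow> complex) \<Rightarrow> 'i \<Rightarrow> complex"
  by unfold_locales (auto simp: cscale_def fun_eq_iff algebra_simps)

definition has_complex_dimension :: "('i \<Rightarrow> complex) set \<Rightarrow> nat \<Rightarrow> bool" where
  "has_complex_dimension S d \<longleftrightarrow> (\<forall>y \<in> S. cfun.dim (tangent_vectors S y) = d)"

definition differential ::
  "(('i \<Rightarrow> complex) \<Rightarrow> complex) \<Rightarrow> ('i \<Rightarrow> complex) \<Rightarrow> ('i \<Rightarrow> complex) \<Rightarrow> complex" where
  "differential f y v = deriv (\<lambda>t :: complex. f (y + cscale t v)) 0"

text \<open>
  Functional independence on \<open>S\<close>: on a dense open subset of \<open>S\<close> the differentials, restricted to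
  the tangent spaces of \<open>S\<close>, are linearly independent.
\<close>

definition functionally_independent_on ::
  "('i \<Rightarrow> complex) set \<Rightarrow> nat \<Rightarrow> (nat \<Rightarrow> ('i \<Rightarrow> complex) \<Rightarrow> complex) \<Rightarrow> bool" where
  "functionally_independent_on S n H \<longleftrightarrow>
     (\<exists>W. openin (top_of_set S) W \<and> S \<subseteq> closure W \<and>
        (\<forall>y \<in> W. \<forall>c :: nat \<Rightarrow> complex.
           (\<forall>v \<in> tangent_vectors S y. (\<Sum>j<n. c j * differential (H j) y v) = 0) \<longrightarrow>
           (\<forall>j<n. c j = 0)))"

text \<open>
  Liouville integrability; the generic leaves are those through the points of some dense open set.
\<close>

definition completely_integrable ::
  "'i set \<Rightarrow> 'i bracket \<Rightarrow> nat \<Rightarrow> (nat \<Rightarrow> ('i \<Rightarrow> complex) \<Rightarrow> complex) \<Rightarrow> bool" where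
  "completely_integrable I br n H \<longleftrightarrow>
     poisson_bracket I br \<and>
     (\<forall>j<n. H j \<in> polynomial_functions I) \<and>
     (\<forall>i<n. \<forall>j<n. br (H i) (H j) = 0) \<and>
     (\<exists>U. openin (top_of_set (affine_space I)) U \<and> affine_space I \<subseteq> closure U \<and>
        (\<forall>x \<in> U. has_complex_dimension (symplectic_leaf I br x) (2 * n) \<and>
                 functionally_independent_on (symplectic_leaf I br x) n H))"


section \<open>The phase space of Lax matrices\<close>

text \<open>\<open>CP i\<close>, \<open>CQ i\<close>, \<open>CR i\<close> index the coefficients of degree \<open>i\<close> of the three entries.\<close>

datatype coord = CP nat | CQ nat | CR nat

definition coords :: "nat \<Rightarrow> coord set" where
  "coords g = CP ` {..g} \<union> CQ ` {..g} \<union> CR ` {..<g}"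

definition P_poly :: "nat \<Rightarrow> (coord \<Rightarrow> complex) \<Rightarrow> complex poly" where
  "P_poly g x = monom 1 (g + 1) + (\<Sum>i\<le>g. monom (x (CP i)) i)"

definition Q_poly :: "nat \<Rightarrow> (coord \<Rightarrow> complex) \<Rightarrow> complex poly" where
  "Q_poly g x = (\<Sum>i\<le>g. monom (x (CQ i)) i)"

definition R_poly :: "nat \<Rightarrow> (coord \<Rightarrow> complex) \<Rightarrow> complex poly" where
  "R_poly g x = monom 1 g + (\<Sum>i<g. monom (x (CR i)) i)"

definition lax_matrix :: "nat \<Rightarrow> (coord \<Rightarrow> complex) \<Rightarrow> complex poly ^ 2 ^ 2" where
  "lax_matrix g x = vector [vector [P_poly g x, R_poly g x], vector [Q_poly g x, - P_poly g x]]"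

definition F_poly :: "nat \<Rightarrow> (coord \<Rightarrow> complex) \<Rightarrow> complex poly" where
  "F_poly g x = - det (lax_matrix g x)"

definition hamiltonian :: "nat \<Rightarrow> nat \<Rightarrow> (coord \<Rightarrow> complex) \<Rightarrow> complex" where
  "hamiltonian g j x = coeff (F_poly g x) j"

text \<open>For a fixed number \<open>\<zeta>\<close> these are polynomial functions on the phase space.\<close>

definition P_at :: "nat \<Rightarrow> complex \<Rightarrow> (coord \<Rightarrow> complex) \<Rightarrow> complex" where
  "P_at g \<zeta> x = poly (P_poly g x) \<zeta>"

definition Q_at :: "nat \<Rightarrow> complex \<Rightarrow> (coord \<Rightarrow> complex) \<Rightarrow> complex" where
  "Q_at g \<zeta> x = poly (Q_poly g x) \<zeta>"

definition R_at :: "nat \<Rightarrow> complex \<Rightarrow> (coord \<Rightarrow> complex) \<Rightarrow> complex" where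
  "R_at g \<zeta> x = poly (R_poly g x) \<zeta>"

text \<open>
  The generating-function identities are imposed for all pairs of distinct numbers \<open>\<zeta>, \<eta>\<close>. As the
  bracket is bilinear and all the quotients are polynomial in \<open>\<zeta>, \<eta>\<close>, this is the same as equating
  the coefficients of all monomials in \<open>\<zeta>, \<eta>\<close>.
\<close>

definition lax_bracket :: "nat \<Rightarrow> coord bracket \<Rightarrow> bool" where
  "lax_bracket g br \<longleftrightarrow>
     skew_biderivation (coords g) br \<and>
     (\<forall>x \<in> affine_space (coords g). \<forall>\<zeta> \<eta>. \<zeta> \<noteq> \<eta> \<longrightarrow>
        br (P_at g \<zeta>) (P_at g \<eta>) x = 0 \<and>
        br (R_at g \<zeta>) (R_at g \<eta>) x = 0 \<and>
        br (P_at g \<zeta>) (Q_at g \<eta>) x = 2 * ((Q_at g \<zeta> x - Q_at g \<eta> x) / (\<zeta> - \<eta>)) \<and>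
        br (P_at g \<zeta>) (R_at g \<eta>) x = - 2 * ((R_at g \<zeta> x - R_at g \<eta> x) / (\<zeta> - \<eta>)) \<and>
        br (Q_at g \<zeta>) (Q_at g \<eta>) x = - 4 * (Q_at g \<zeta> x - Q_at g \<eta> x) \<and>
        br (Q_at g \<zeta>) (R_at g \<eta>) x =
          4 * ((P_at g \<zeta> x - P_at g \<eta> x) / (\<zeta> - \<eta>)) - 4 * R_at g \<eta> x)"


subsection \<open>The coordinates describe the intended space of matrices\<close>

lemma card_coords: "card (coords g) = 3 * g + 2"
proof -
  have "card (CP ` {..g} \<union> CQ ` {..g} \<union> CR ` {..<g}) =
        card (CP ` {..g}) + card (CQ ` {..g}) + card (CR ` {..<g})"
    by (subst card_Un_disjoint; auto simp: card_Un_disjoint)+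
  then show ?thesis
    by (simp add: coords_def card_image inj_on_def)
qed

lemma coeff_P_poly: "coeff (P_poly g x) i = (if i \<le> g then x (CP i) else if i = g + 1 then 1 else 0)"
  by (auto simp: P_poly_def coeff_sum sum.delta)

lemma coeff_Q_poly: "coeff (Q_poly g x) i = (if i \<le> g then x (CQ i) else 0)"
  by (auto simp: Q_poly_def coeff_sum sum.delta)

lemma coeff_R_poly: "coeff (R_poly g x) i = (if i < g then x (CR i) else if i = g then 1 else 0)"
  by (auto simp: R_poly_def coeff_sum sum.delta)

lemma F_poly_eq: "F_poly g x = (P_poly g x)\<^sup>2 + Q_poly g x * R_poly g x"
  by (simp add: F_poly_def lax_matrix_def det_2 power2_eq_square algebra_simps)

lemma lax_matrix_bij:
  "bij_betw (lax_matrix g) (affine_space (coords g))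
     {L. \<exists>P Q R. L = vector [vector [P, R], vector [Q, - P]] \<and>
           degree P = g + 1 \<and> lead_coeff P = 1 \<and>
           degree R = g \<and> lead_coeff R = 1 \<and> degree Q \<le> g}"
    (is "bij_betw _ ?A ?M")
proof -
  have deg: "degree (P_poly g x) = g + 1" "degree (R_poly g x) = g" "degree (Q_poly g x) \<le> g" for x
    by (intro antisym degree_le le_degree; simp add: coeff_P_poly coeff_Q_poly coeff_R_poly)+
  have into: "lax_matrix g x \<in> ?M" for x
    using deg[of x] unfolding lax_matrix_def
    by (intro CollectI exI[of _ "P_poly g x"] exI[of _ "Q_poly g x"] exI[of _ "R_poly g x"])
       (simp add: coeff_P_poly coeff_R_poly)
  have inj: "inj_on (lax_matrix g) ?A"
  proof (rule inj_onI)
    fix x y assume xy: "x \<in> ?A" "y \<in> ?A" "lax_matrix g x = lax_matrix g y"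
    have eqs: "P_poly g x = P_poly g y" "Q_poly g x = Q_poly g y" "R_poly g x = R_poly g y"
      using arg_cong[OF xy(3), of "\<lambda>L. L $ 1 $ 1"] arg_cong[OF xy(3), of "\<lambda>L. L $ 2 $ 1"]
        arg_cong[OF xy(3), of "\<lambda>L. L $ 1 $ 2"]
      by (simp_all add: lax_matrix_def)
    show "x = y"
    proof
      fix i show "x i = y i"
      proof (cases "i \<in> coords g")
        case False
        then show ?thesis using xy by (simp add: affine_space_def)
      next
        case True
        then show ?thesis
          using arg_cong[OF eqs(1), of coeff] arg_cong[OF eqs(2), of coeff]
            arg_cong[OF eqs(3), of coeff]
          by (auto simp: coords_def fun_eq_iff coeff_P_poly coeff_Q_poly coeff_R_poly split: if_splits)
      qed
    qed
  qed
  have onto: "L \<in> lax_matrix g ` ?A" if "L \<in> ?M" for L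
  proof -
    from that obtain P Q R where L: "L = vector [vector [P, R], vector [Q, - P]]"
      and d: "degree P = g + 1" "lead_coeff P = 1" "degree R = g" "lead_coeff R = 1" "degree Q \<le> g"
      by blast
    define x where "x i = (if i \<in> coords g then
      (case i of CP k \<Rightarrow> coeff P k | CQ k \<Rightarrow> coeff Q k | CR k \<Rightarrow> coeff R k) else 0)" for i
    have "x \<in> ?A" by (simp add: x_def affine_space_def)
    moreover have "P_poly g x = P" "Q_poly g x = Q" "R_poly g x = R"
      using d by (auto simp: poly_eq_iff coeff_P_poly coeff_Q_poly coeff_R_poly x_def coords_def
          intro: coeff_eq_0)
    ultimately show ?thesis by (auto simp: lax_matrix_def L intro!: image_eqI[of _ _ x])
  qed
  have "lax_matrix g ` ?A = ?M"
    by (rule subset_antisym; rule subsetI) (use into onto in \<open>blast+\<close>)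
  then show ?thesis using inj by (simp only: bij_betw_def simp_thms)
qed

end

theory Submission
  imports
    Defs
    "HOL-Computational_Algebra.Field_as_Ring"
    "HOL-Computational_Algebra.Polynomial_Factorial"
    "HOL-Computational_Algebra.Fundamental_Theorem_Algebra"
begin

text \<open>
  Comparing coefficients turns the generating-function identities into linear brackets of the
  coefficients, from which the Jacobi identity is a finite check. The brackets of \<open>F(\<zeta>)\<close> with the
  entries of the Lax matrix at \<open>\<eta>\<close> show that the \<open>c\<^sub>j\<close> are in involution and that those with
  \<open>j \<ge> g\<close> are Casimir functions. As R is monic, the Hamiltonian fields of the \<open>g\<close> lowest
  coefficients of P and of R form a frame of the common kernel of the differentials of the Casimir
  functions at every point, and their flows are polynomial in time. So every leaf has dimension
  \<open>2 g\<close>, without any genericity assumption. The differentials of all \<open>c\<^sub>j\<close> are independent wherever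
  P and R have no common root, by Bezout's identity; along the flow of the coefficient of R of
  degree \<open>g - 1\<close>, which fixes R and translates P by a constant, this holds for all but finitely
  many times.
\<close>

section \<open>Polynomial functions and their differentials\<close>

text \<open>A leaf is here only a set of reachable points, and its tangent vectors are velocities of
  curves in it, so its dimension is squeezed between two bounds. Explicit flows produce tangent
  vectors; constancy of the Casimir functions confines every velocity to the kernel of their
  differentials. As the flows used are polynomials in time, neither an existence theorem for
  differential equations nor a manifold structure on the leaf enters. The count agrees: c_g, ...,
  c_(2g+1) are g + 2 functions on a space of dimension 3g + 2, which leaves 2g. The Jacobi identity
  is derived for every skew biderivation that satisfies the relations. For existence it is therefore
  enough to write down a skew biderivation with the right values on coordinates.\<close>

lemma polynomial_functions_cmult:
  assumes "f \<in> polynomial_functions I"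
  shows "(\<lambda>x. c * f x) \<in> polynomial_functions I"
  using polynomial_functions.mult[OF polynomial_functions.const[of c] assms]
  by (simp add: times_fun_def)

lemma polynomial_functions_lin2:
  assumes "f \<in> polynomial_functions I" "h \<in> polynomial_functions I"
  shows "(\<lambda>x. a * f x + b * h x) \<in> polynomial_functions I"
  using polynomial_functions.add[OF polynomial_functions_cmult[OF assms(1), of a]
      polynomial_functions_cmult[OF assms(2), of b]]
  by (simp add: plus_fun_def)

lemma polynomial_functions_sum:
  assumes "\<And>k. k \<in> K \<Longrightarrow> f k \<in> polynomial_functions I"
  shows "(\<Sum>k\<in>K. f k) \<in> polynomial_functions I"
  using assms
proof (induction K rule: infinite_finite_induct)
  case (insert k K)
  then show ?case
    by (simp add: polynomial_functions.add del: plus_fun_apply)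
qed (use polynomial_functions.const[of 0 I] in \<open>auto simp: zero_fun_def\<close>)

lemma sum_fun_apply: "(\<Sum>k\<in>K. f k) x = (\<Sum>k\<in>K. f k x)"
  for f :: "'k \<Rightarrow> 'a \<Rightarrow> 'b::comm_monoid_add"
  by (induction K rule: infinite_finite_induct) auto

lemma polynomial_functions_lincomb:
  assumes "\<And>k. k \<in> K \<Longrightarrow> f k \<in> polynomial_functions I"
  shows "(\<lambda>x. \<Sum>k\<in>K. c k * f k x) \<in> polynomial_functions I"
proof -
  have "(\<lambda>x. \<Sum>k\<in>K. c k * f k x) = (\<Sum>k\<in>K. (\<lambda>x. c k * f k x))"
    by (simp add: fun_eq_iff sum_fun_apply)
  then show ?thesis
    by (simp add: polynomial_functions_sum polynomial_functions_cmult assms)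
qed

lemma polynomial_functions_cong:
  assumes "f \<in> polynomial_functions I" "\<And>i. i \<in> I \<Longrightarrow> x i = y i"
  shows "f x = f y"
  using assms by induction auto

text \<open>\<open>lax_bracket\<close> constrains brackets only at points of the affine space. As
  polynomial functions ignore all other coordinates, such pointwise relations become equalities of
  functions, which nested brackets require.\<close>

lemma polynomial_functions_eqI:
  assumes "f \<in> polynomial_functions I" "h \<in> polynomial_functions I"
    and "\<And>x. x \<in> affine_space I \<Longrightarrow> f x = h x"
  shows "f = h"
proof
  fix x :: "'a \<Rightarrow> complex"
  let ?y = "\<lambda>i. if i \<in> I then x i else 0"
  have "f x = f ?y" "h x = h ?y"
    by (rule polynomial_functions_cong[OF assms(1)] polynomial_functions_cong[OF assms(2)]; simp)+
  then show "f x = h x"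
    using assms(3)[of ?y] by (simp add: affine_space_def)
qed

section \<open>Directional derivatives of polynomial functions\<close>

lemma polynomial_function_line_differentiable:
  assumes "f \<in> polynomial_functions I"
  shows "(\<lambda>t. f (x + cscale t v)) field_differentiable (at t)"
  using assms
proof induction
  case (coord i)
  then show ?case
    by (auto simp: cscale_def intro!: derivative_intros)
qed (auto intro!: derivative_intros)

lemma differential_const [simp]: "differential (\<lambda>_. c) x v = 0"
  by (simp add: differential_def)

lemma differential_coord [simp]: "differential (\<lambda>x. x i) x v = v i"
proof -
  have "((\<lambda>t. x i + t * v i) has_field_derivative v i) (at 0)"
    by (auto intro!: derivative_eq_intros)
  then show ?thesis
    by (simp add: differential_def cscale_def DERIV_imp_deriv)
qed

lemma differential_add:
  assumes "f \<in> polynomial_functions I" "h \<in> polynomial_functions I"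
  shows "differential (f + h) x v = differential f x v + differential h x v"
  using polynomial_function_line_differentiable[OF assms(1)]
    polynomial_function_line_differentiable[OF assms(2)]
  by (simp add: differential_def)

lemma differential_mult:
  assumes "f \<in> polynomial_functions I" "h \<in> polynomial_functions I"
  shows "differential (f * h) x v = f x * differential h x v + h x * differential f x v"
  using polynomial_function_line_differentiable[OF assms(1)]
    polynomial_function_line_differentiable[OF assms(2)]
  by (simp add: differential_def cscale_def plus_fun_def algebra_simps)

lemma differential_lincomb:
  assumes "f \<in> polynomial_functions I"
  shows "differential f x (\<lambda>i. \<Sum>k\<in>K. c k * v k i) = (\<Sum>k\<in>K. c k * differential f x (v k))"
  using assms
proof induction
  case (add f h)
  show ?case
    unfolding differential_add[OF add.hyps] add.IH by (simp add: sum.distrib algebra_simps)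
next
  case (mult f h)
  show ?case
    unfolding differential_mult[OF mult.hyps] mult.IH
    by (simp add: sum.distrib sum_distrib_left algebra_simps)
qed auto

lemma differential_polynomial:
  assumes "f \<in> polynomial_functions I"
  shows "(\<lambda>x. differential f x v) \<in> polynomial_functions I"
  using assms
proof induction
  case (add f h)
  have "(\<lambda>x. differential (f + h) x v) = (\<lambda>x. differential f x v) + (\<lambda>x. differential h x v)"
    unfolding differential_add[OF add.hyps] by (simp add: fun_eq_iff)
  then show ?case
    using add.IH by (metis polynomial_functions.add)
next
  case (mult f h)
  have "(\<lambda>x. differential (f * h) x v) =
      f * (\<lambda>x. differential h x v) + h * (\<lambda>x. differential f x v)"
    unfolding differential_mult[OF mult.hyps] by (simp add: fun_eq_iff)
  then show ?case
    using mult by (metis polynomial_functions.add polynomial_functions.mult)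
qed (auto intro: polynomial_functions.intros)

text \<open>The chain rule. The filter \<open>at t within T\<close> covers both the closed time
  interval of a \<open>hamiltonian_step\<close> and the two-sided derivatives in
  \<open>tangent_vectors\<close>.\<close>

lemma polynomial_function_has_vector_derivative:
  assumes "f \<in> polynomial_functions I"
    and "\<And>i. i \<in> I \<Longrightarrow> ((\<lambda>s. \<gamma> s i) has_vector_derivative v i) (at t within T)"
  shows "((\<lambda>s. f (\<gamma> s)) has_vector_derivative differential f (\<gamma> t) v) (at t within T)"
  using assms
proof induction
  case (add f h)
  then show ?case
    unfolding differential_add[OF add.hyps] by (auto intro!: has_vector_derivative_add)
next
  case (mult f h)
  then show ?case
    unfolding differential_mult[OF mult.hyps]
    by (auto simp: mult.commute intro!: derivative_eq_intros)
qed auto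

section \<open>Skew biderivations\<close>

context
  fixes I :: "'i set" and br :: "'i bracket"
  assumes skew_biderivation: "skew_biderivation I br"
begin

lemma bracket_polynomial:
  "f \<in> polynomial_functions I \<Longrightarrow> h \<in> polynomial_functions I \<Longrightarrow> br f h \<in> polynomial_functions I"
  using skew_biderivation unfolding skew_biderivation_def by blast

lemma bracket_skew:
  "f \<in> polynomial_functions I \<Longrightarrow> h \<in> polynomial_functions I \<Longrightarrow> br f h = - br h f"
  using skew_biderivation unfolding skew_biderivation_def by blast

lemma bracket_add_left:
  "f \<in> polynomial_functions I \<Longrightarrow> f' \<in> polynomial_functions I \<Longrightarrow> h \<in> polynomial_functions I
    \<Longrightarrow> br (f + f') h = br f h + br f' h"
  using skew_biderivation unfolding skew_biderivation_def by blast

lemma bracket_mult_left: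
  "f \<in> polynomial_functions I \<Longrightarrow> f' \<in> polynomial_functions I \<Longrightarrow> h \<in> polynomial_functions I
    \<Longrightarrow> br (f * f') h = f * br f' h + f' * br f h"
  using skew_biderivation unfolding skew_biderivation_def by blast

lemma bracket_cmult_left:
  assumes "f \<in> polynomial_functions I" "h \<in> polynomial_functions I"
  shows "br (\<lambda>x. c * f x) h = (\<lambda>x. c * br f h x)"
proof -
  have "br ((\<lambda>_. c) * f) h = (\<lambda>_. c) * br f h"
    using skew_biderivation assms unfolding skew_biderivation_def by blast
  then show ?thesis by (simp add: times_fun_def)
qed

lemma bracket_cmult_right:
  assumes "f \<in> polynomial_functions I" "h \<in> polynomial_functions I"
  shows "br h (\<lambda>x. c * f x) = (\<lambda>x. c * br h f x)"
  unfolding bracket_skew[OF assms(2) polynomial_functions_cmult[OF assms(1)]]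
    bracket_cmult_left[OF assms] bracket_skew[OF assms(2,1)]
  by (simp add: fun_eq_iff)

lemma bracket_add_right:
  assumes "f \<in> polynomial_functions I" "f' \<in> polynomial_functions I" "h \<in> polynomial_functions I"
  shows "br h (f + f') = br h f + br h f'"
  unfolding bracket_skew[OF assms(3) polynomial_functions.add[OF assms(1,2)]]
    bracket_add_left[OF assms] bracket_skew[OF assms(3,1)] bracket_skew[OF assms(3,2)]
  by (simp add: fun_eq_iff)

lemma bracket_mult_right:
  assumes "f \<in> polynomial_functions I" "f' \<in> polynomial_functions I" "h \<in> polynomial_functions I"
  shows "br h (f * f') = f * br h f' + f' * br h f"
  unfolding bracket_skew[OF assms(3) polynomial_functions.mult[OF assms(1,2)]]
    bracket_mult_left[OF assms] bracket_skew[OF assms(3,1)] bracket_skew[OF assms(3,2)]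
  by (simp add: fun_eq_iff)

text \<open>Since 1 * 1 = 1, the Leibniz rule makes the bracket of 1 with \<open>h\<close> twice
  itself, hence zero; scaling gives the other constants.\<close>

lemma bracket_const_left:
  assumes "h \<in> polynomial_functions I"
  shows "br (\<lambda>_. c) h = 0"
proof -
  have "br (\<lambda>_. c * 0) h = (\<lambda>x. c * br (\<lambda>_. 0) h x)" for c
    using bracket_cmult_left[OF polynomial_functions.const assms, of c 0] by simp
  from this[of 0] have zero: "br (\<lambda>_. 0) h = 0" by (simp add: zero_fun_def)
  have one: "(\<lambda>_. 1) * (\<lambda>_. 1) = (\<lambda>_::'i \<Rightarrow> complex. 1 :: complex)" by (simp add: times_fun_def)
  have "br (\<lambda>_. 1) h = 0"
    using bracket_mult_left[OF polynomial_functions.const[of 1] polynomial_functions.const[of 1] assms]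
    unfolding one by (simp add: fun_eq_iff)
  then show ?thesis
    using bracket_cmult_left[OF polynomial_functions.const[of 1] assms, of c]
    by (simp add: zero_fun_def)
qed

lemma bracket_const_right:
  "h \<in> polynomial_functions I \<Longrightarrow> br h (\<lambda>_. c) = 0"
  using bracket_skew[of h "\<lambda>_. c"] bracket_const_left[of h c]
  by (simp add: polynomial_functions.const)

lemma bracket_lincomb_left:
  assumes "h \<in> polynomial_functions I" "\<And>k. k \<in> K \<Longrightarrow> f k \<in> polynomial_functions I"
  shows "br (\<lambda>x. \<Sum>k\<in>K. c k * f k x) h = (\<lambda>x. \<Sum>k\<in>K. c k * br (f k) h x)"
  using assms(2)
proof (induction K rule: infinite_finite_induct)
  case (insert k K)
  have eq: "(\<lambda>x. \<Sum>k\<in>insert k K. c k * f k x) = (\<lambda>x. c k * f k x) + (\<lambda>x. \<Sum>k\<in>K. c k * f k x)"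
    using insert.hyps by (simp add: fun_eq_iff)
  show ?case
    unfolding eq using insert assms(1)
    by (subst bracket_add_left)
      (auto simp: fun_eq_iff bracket_cmult_left intro!: polynomial_functions_cmult polynomial_functions_lincomb)
qed (use bracket_const_left[OF assms(1)] in \<open>auto simp: zero_fun_def\<close>)

lemma bracket_lincomb_right:
  assumes "h \<in> polynomial_functions I" "\<And>k. k \<in> K \<Longrightarrow> f k \<in> polynomial_functions I"
  shows "br h (\<lambda>x. \<Sum>k\<in>K. c k * f k x) = (\<lambda>x. \<Sum>k\<in>K. c k * br h (f k) x)"
proof -
  have *: "br h (f k) x = - br (f k) h x" if "k \<in> K" for k x
    using bracket_skew[OF assms(1) assms(2)[OF that]] by simp
  have "br h (\<lambda>x. \<Sum>k\<in>K. c k * f k x) = - br (\<lambda>x. \<Sum>k\<in>K. c k * f k x) h"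
    using assms by (intro bracket_skew polynomial_functions_lincomb)
  also have "\<dots> = (\<lambda>x. \<Sum>k\<in>K. c k * br h (f k) x)"
    using assms by (simp add: bracket_lincomb_left fun_eq_iff sum_negf[symmetric] *)
  finally show ?thesis .
qed

lemma bracket_double_lincomb:
  assumes "\<And>k. k \<in> K \<Longrightarrow> f k \<in> polynomial_functions I"
    and "\<And>l. l \<in> L \<Longrightarrow> h l \<in> polynomial_functions I"
  shows "br (\<lambda>x. \<Sum>k\<in>K. c k * f k x) (\<lambda>x. \<Sum>l\<in>L. d l * h l x) =
    (\<lambda>x. \<Sum>k\<in>K. \<Sum>l\<in>L. c k * d l * br (f k) (h l) x)"
  using assms
  by (simp add: bracket_lincomb_left bracket_lincomb_right polynomial_functions_lincomb
      sum_distrib_left mult.assoc)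

text \<open>Both sides are derivations in \<open>f\<close> that agree on coordinates. This is the
  link from brackets to the curves that make up a leaf.\<close>

lemma bracket_eq_differential:
  assumes "f \<in> polynomial_functions I" "h \<in> polynomial_functions I"
  shows "br f h x = differential f x (hamiltonian_field I br h x)"
  using assms(1)
proof induction
  case (const c)
  show ?case by (simp add: bracket_const_left[OF assms(2)])
next
  case (coord i)
  then show ?case by (simp add: hamiltonian_field_def)
next
  case (add f f')
  then show ?case
    unfolding bracket_add_left[OF add.hyps assms(2)] differential_add[OF add.hyps] by simp
next
  case (mult f f')
  then show ?case
    unfolding bracket_mult_left[OF mult.hyps assms(2)] differential_mult[OF mult.hyps] by simp
qed

lemma bracket_eq_0I:
  assumes "f \<in> polynomial_functions I" "h \<in> polynomial_functions I"
    and "\<And>i. i \<in> I \<Longrightarrow> br (\<lambda>x. x i) h = 0"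
  shows "br f h = 0"
  using assms(1)
proof induction
  case (const c)
  show ?case by (rule bracket_const_left[OF assms(2)])
next
  case (coord i)
  then show ?case by (rule assms(3))
next
  case (add f f')
  show ?case unfolding bracket_add_left[OF add.hyps assms(2)] add.IH by simp
next
  case (mult f f')
  show ?case unfolding bracket_mult_left[OF mult.hyps assms(2)] mult.IH by simp
qed

section \<open>Reduction of the Jacobi identity to coordinate functions\<close>

definition jacobiator where
  "jacobiator f h k = br (br f h) k + br (br h k) f + br (br k f) h"

lemma jacobiator_cyclic: "jacobiator f h k = jacobiator h k f"
  by (simp add: jacobiator_def)

lemma jacobiator_add:
  assumes "f \<in> polynomial_functions I" "f' \<in> polynomial_functions I"
    "h \<in> polynomial_functions I" "k \<in> polynomial_functions I"
  shows "jacobiator (f + f') h k = jacobiator f h k + jacobiator f' h k"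
  using assms
  by (simp add: jacobiator_def bracket_add_left bracket_add_right bracket_polynomial
      polynomial_functions.add)

text \<open>Mixed products such as \<open>br f' h * br f k\<close> arise once from the first and
  once from the third nested bracket, and skew-symmetry gives them opposite signs. What remains is a
  derivation in the first argument.\<close>

lemma jacobiator_mult:
  assumes "f \<in> polynomial_functions I" "f' \<in> polynomial_functions I"
    "h \<in> polynomial_functions I" "k \<in> polynomial_functions I"
  shows "jacobiator (f * f') h k = f * jacobiator f' h k + f' * jacobiator f h k"
proof -
  have "br (br (f * f') h) k = f * br (br f' h) k + br f' h * br f k + f' * br (br f h) k + br f h * br f' k"
    using assms by (simp add: bracket_mult_left bracket_add_left bracket_polynomial
        polynomial_functions.add polynomial_functions.mult algebra_simps fun_eq_iff)
  moreover have "br (br h k) (f * f') = f * br (br h k) f' + f' * br (br h k) f"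
    using assms by (simp add: bracket_mult_right bracket_polynomial)
  moreover have "br (br k (f * f')) h = f * br (br k f') h + br k f' * br f h + f' * br (br k f) h + br k f * br f' h"
    using assms by (simp add: bracket_mult_left bracket_mult_right bracket_add_left bracket_polynomial
        polynomial_functions.add polynomial_functions.mult algebra_simps fun_eq_iff)
  moreover have "br f k = - br k f" "br f' k = - br k f'"
    using assms by (auto intro: bracket_skew)
  ultimately show ?thesis
    by (simp add: jacobiator_def algebra_simps fun_eq_iff)
qed

lemma jacobiator_eq_0_step:
  assumes "f \<in> polynomial_functions I" "h \<in> polynomial_functions I" "k \<in> polynomial_functions I"
    and "\<And>i. i \<in> I \<Longrightarrow> jacobiator (\<lambda>x. x i) h k = 0"
  shows "jacobiator f h k = 0"
  using assms(1)
proof induction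
  case (const c)
  have "br (\<lambda>_. 0) h = 0" "br (\<lambda>_. 0) k = 0"
    using assms by (auto simp: bracket_const_left)
  then show ?case
    using assms
    by (simp add: jacobiator_def bracket_const_left bracket_const_right bracket_polynomial
        zero_fun_def)
next
  case (coord i)
  then show ?case by (rule assms(4))
next
  case (add f f')
  show ?case unfolding jacobiator_add[OF add.hyps assms(2,3)] add.IH by simp
next
  case (mult f f')
  show ?case unfolding jacobiator_mult[OF mult.hyps assms(2,3)] mult.IH by simp
qed

lemma poisson_bracketI:
  assumes jac: "\<And>i j k. i \<in> I \<Longrightarrow> j \<in> I \<Longrightarrow> k \<in> I \<Longrightarrow>
      jacobiator (\<lambda>x. x i) (\<lambda>x. x j) (\<lambda>x. x k) = 0"
  shows "poisson_bracket I br"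
proof -
  have coord: "(\<lambda>x. x i) \<in> polynomial_functions I" if "i \<in> I" for i
    using that by (rule polynomial_functions.coord)
  \<comment> \<open>The arguments are generalised one at a time; cyclic rotation brings each of them
    to the first slot, where \<open>jacobiator_eq_0_step\<close> applies.\<close>
  have 1: "jacobiator f (\<lambda>x. x j) (\<lambda>x. x k) = 0"
    if "f \<in> polynomial_functions I" "j \<in> I" "k \<in> I" for f j k
    by (rule jacobiator_eq_0_step[OF that(1) coord[OF that(2)] coord[OF that(3)] jac[OF _ that(2,3)]])
  have 2: "jacobiator f h (\<lambda>x. x k) = 0"
    if "f \<in> polynomial_functions I" "h \<in> polynomial_functions I" "k \<in> I" for f h k
    unfolding jacobiator_cyclic[of f h]
    by (rule jacobiator_eq_0_step[OF that(2) coord[OF that(3)] that(1)],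
        subst jacobiator_cyclic, subst jacobiator_cyclic, rule 1[OF that(1) _ that(3)])
  have 3: "jacobiator f h k = 0"
    if "f \<in> polynomial_functions I" "h \<in> polynomial_functions I" "k \<in> polynomial_functions I" for f h k
    by (subst jacobiator_cyclic, subst jacobiator_cyclic, rule jacobiator_eq_0_step[OF that(3,1,2)],
        subst jacobiator_cyclic, rule 2[OF that(1,2)])
  show ?thesis
    using skew_biderivation 3 by (simp add: poisson_bracket_def jacobiator_def)
qed

end

section \<open>The bracket in terms of coefficients\<close>

definition P_coeff :: "nat \<Rightarrow> nat \<Rightarrow> (coord \<Rightarrow> complex) \<Rightarrow> complex" where
  "P_coeff g i x = coeff (P_poly g x) i"

definition Q_coeff :: "nat \<Rightarrow> nat \<Rightarrow> (coord \<Rightarrow> complex) \<Rightarrow> complex" where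
  "Q_coeff g i x = coeff (Q_poly g x) i"

definition R_coeff :: "nat \<Rightarrow> nat \<Rightarrow> (coord \<Rightarrow> complex) \<Rightarrow> complex" where
  "R_coeff g i x = coeff (R_poly g x) i"

lemmas coeff_fun_defs = P_coeff_def Q_coeff_def R_coeff_def

lemmas coeff_fun_simps =
  P_coeff_def[unfolded coeff_P_poly] Q_coeff_def[unfolded coeff_Q_poly] R_coeff_def[unfolded coeff_R_poly]

lemma coord_coeff:
  "i \<le> g \<Longrightarrow> P_coeff g i = (\<lambda>x. x (CP i))"
  "i \<le> g \<Longrightarrow> Q_coeff g i = (\<lambda>x. x (CQ i))"
  "i < g \<Longrightarrow> R_coeff g i = (\<lambda>x. x (CR i))"
  by (auto simp: coeff_fun_simps fun_eq_iff)

lemma const_coeff: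
  "P_coeff g (Suc g) = (\<lambda>_. 1)"
  "i > Suc g \<Longrightarrow> P_coeff g i = (\<lambda>_. 0)"
  "i > g \<Longrightarrow> Q_coeff g i = (\<lambda>_. 0)"
  "R_coeff g g = (\<lambda>_. 1)"
  "i > g \<Longrightarrow> R_coeff g i = (\<lambda>_. 0)"
  by (auto simp: coeff_fun_simps fun_eq_iff)

lemma coeff_fun_polynomial:
  "P_coeff g i \<in> polynomial_functions (coords g)"
  "Q_coeff g i \<in> polynomial_functions (coords g)"
  "R_coeff g i \<in> polynomial_functions (coords g)"
proof -
  have const: "(\<lambda>_. c) \<in> polynomial_functions (coords g)" for c
    by (rule polynomial_functions.const)
  have coord: "i \<le> g \<Longrightarrow> (\<lambda>x. x (CP i)) \<in> polynomial_functions (coords g)"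
      "i \<le> g \<Longrightarrow> (\<lambda>x. x (CQ i)) \<in> polynomial_functions (coords g)"
      "i < g \<Longrightarrow> (\<lambda>x. x (CR i)) \<in> polynomial_functions (coords g)"
    by (rule polynomial_functions.coord; simp add: coords_def)+
  consider "i \<le> g" | "i = Suc g" | "i > Suc g" by linarith
  then show "P_coeff g i \<in> polynomial_functions (coords g)"
    by cases (simp_all add: coord_coeff const_coeff const coord)
  consider "i \<le> g" | "i > g" by linarith
  then show "Q_coeff g i \<in> polynomial_functions (coords g)"
    by cases (simp_all add: coord_coeff const_coeff const coord)
  consider "i < g" | "i = g" | "i > g" by linarith
  then show "R_coeff g i \<in> polynomial_functions (coords g)"
    by cases (simp_all add: coord_coeff const_coeff const coord)
qed

section \<open>Comparing coefficients of generating functions\<close>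

lemma poly_eq_sum_bound:
  fixes p :: "'a::comm_semiring_1 poly"
  assumes "degree p \<le> n"
  shows "poly p z = (\<Sum>i\<le>n. z ^ i * coeff p i)"
proof -
  have "poly p z = (\<Sum>i\<le>degree p. z ^ i * coeff p i)"
    by (auto simp: poly_altdef mult.commute intro!: sum.cong)
  also have "\<dots> = (\<Sum>i\<le>n. z ^ i * coeff p i)"
    using assms by (intro sum.mono_neutral_left) (auto intro: le_degree)
  finally show ?thesis .
qed

lemma degree_poly:
  "degree (P_poly g x) = Suc g" "degree (Q_poly g x) \<le> g" "degree (R_poly g x) = g"
  by (intro antisym degree_le le_degree; simp add: coeff_P_poly coeff_Q_poly coeff_R_poly)+

text \<open>All three sums run up to \<open>Suc g\<close>, beyond the degrees of Q and R, so that
  one bound serves every pair of entries.\<close>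

lemma at_eq_sum:
  "P_at g \<zeta> = (\<lambda>x. \<Sum>i\<le>Suc g. \<zeta> ^ i * P_coeff g i x)"
  "Q_at g \<zeta> = (\<lambda>x. \<Sum>i\<le>Suc g. \<zeta> ^ i * Q_coeff g i x)"
  "R_at g \<zeta> = (\<lambda>x. \<Sum>i\<le>Suc g. \<zeta> ^ i * R_coeff g i x)"
  using degree_poly(2)[of g]
  by (auto simp: fun_eq_iff P_at_def Q_at_def R_at_def coeff_fun_defs degree_poly le_SucI
      simp del: sum.atMost_Suc intro!: poly_eq_sum_bound)

lemma at_polynomial:
  "P_at g \<zeta> \<in> polynomial_functions (coords g)"
  "Q_at g \<zeta> \<in> polynomial_functions (coords g)"
  "R_at g \<zeta> \<in> polynomial_functions (coords g)"
  unfolding at_eq_sum by (intro polynomial_functions_lincomb coeff_fun_polynomial)+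

text \<open>The identity is available only off the diagonal. For fixed \<eta> this still leaves
  infinitely many \<zeta>, so each coefficient with respect to \<zeta> vanishes, and it does so for
  every \<eta>.\<close>

lemma bivariate_coeffs_eq_0:
  fixes a :: "nat \<Rightarrow> nat \<Rightarrow> complex"
  assumes "\<And>\<zeta> \<eta>. \<zeta> \<noteq> \<eta> \<Longrightarrow> (\<Sum>i\<le>m. \<Sum>j\<le>n. \<zeta> ^ i * \<eta> ^ j * a i j) = 0"
    and "i \<le> m" "j \<le> n"
  shows "a i j = 0"
proof -
  have "(\<Sum>j\<le>n. a i j * \<eta> ^ j) = 0" for \<eta>
  proof -
    have "UNIV - {\<eta>} \<subseteq> {\<zeta>. (\<Sum>i\<le>m. (\<Sum>j\<le>n. a i j * \<eta> ^ j) * \<zeta> ^ i) = 0}"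
      using assms(1)[of _ \<eta>] by (auto simp: sum_distrib_left sum_distrib_right ac_simps)
    then have "infinite {\<zeta>. (\<Sum>i\<le>m. (\<Sum>j\<le>n. a i j * \<eta> ^ j) * \<zeta> ^ i) = 0}"
      using infinite_UNIV_char_0[where 'a=complex] by (meson finite.emptyI finite_Diff2 finite_insert finite_subset)
    then show ?thesis
      using polyfun_finite_roots[where n = m and c = "\<lambda>i. \<Sum>j\<le>n. a i j * \<eta> ^ j"] assms(2) by blast
  qed
  then show ?thesis
    using polyfun_eq_0[where n = n and c = "a i"] assms(3) by blast
qed

lemma difference_quotient_sum:
  fixes a :: "nat \<Rightarrow> complex"
  assumes "\<And>k. k > n \<Longrightarrow> a k = 0" and "\<zeta> \<noteq> \<eta>"
  shows "(\<Sum>i\<le>n. \<Sum>j\<le>n. \<zeta> ^ i * \<eta> ^ j * a (Suc (i + j))) =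
    ((\<Sum>k\<le>n. \<zeta> ^ k * a k) - (\<Sum>k\<le>n. \<eta> ^ k * a k)) / (\<zeta> - \<eta>)"
proof -
  \<comment> \<open>Multiplication by \<zeta> or \<eta> shifts one index of \<open>b\<close>. Each
    shifted double sum is the full sum minus a boundary row, and only these rows survive in the
    difference; nothing is added at the top, where \<open>b\<close> vanishes.\<close>
  define b where "b i j = \<zeta> ^ i * \<eta> ^ j * a (i + j)" for i j
  have b0: "b (Suc n) j = 0" "b j (Suc n) = 0" for j
    using assms(1) by (simp_all add: b_def)
  have 1: "(\<Sum>i\<le>n. b (Suc i) j) = (\<Sum>i\<le>n. b i j) - b 0 j" for j
    using sum.atMost_Suc_shift[of "\<lambda>i. b i j" n] b0 by (simp add: algebra_simps)
  have 2: "(\<Sum>j\<le>n. b i (Suc j)) = (\<Sum>j\<le>n. b i j) - b i 0" for i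
    using sum.atMost_Suc_shift[of "\<lambda>j. b i j" n] b0 by (simp add: algebra_simps)
  have "(\<zeta> - \<eta>) * (\<Sum>i\<le>n. \<Sum>j\<le>n. \<zeta> ^ i * \<eta> ^ j * a (Suc (i + j))) =
      (\<Sum>i\<le>n. \<Sum>j\<le>n. b (Suc i) j) - (\<Sum>i\<le>n. \<Sum>j\<le>n. b i (Suc j))"
    by (simp add: b_def sum_distrib_left sum_subtractf[symmetric] algebra_simps)
  also have "(\<Sum>i\<le>n. \<Sum>j\<le>n. b (Suc i) j) = (\<Sum>i\<le>n. \<Sum>j\<le>n. b i j) - (\<Sum>j\<le>n. b 0 j)"
    by (subst (1 2) sum.swap) (simp add: 1 sum_subtractf)
  also have "(\<Sum>i\<le>n. \<Sum>j\<le>n. b i (Suc j)) = (\<Sum>i\<le>n. \<Sum>j\<le>n. b i j) - (\<Sum>i\<le>n. b i 0)"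
    by (simp add: 2 sum_subtractf)
  finally show ?thesis
    using assms(2) by (simp add: b_def field_simps)
qed

text \<open>\<open>K\<close> is the coefficient matrix of the right-hand side. Beyond
  \<open>n\<close> one argument of the bracket is the constant 0 and \<open>K\<close> vanishes, so
  the equivalence reaches all indices.\<close>

lemma generating_function_bracket_iff:
  assumes skew: "skew_biderivation I br"
    and poly: "\<And>i. u i \<in> polynomial_functions I" "\<And>j. w j \<in> polynomial_functions I"
    and zero: "\<And>i. i > n \<Longrightarrow> u i = (\<lambda>_. 0)" "\<And>j. j > n \<Longrightarrow> w j = (\<lambda>_. 0)"
      "\<And>i j. i > n \<or> j > n \<Longrightarrow> K i j = 0"
  shows "(\<forall>\<zeta> \<eta>. \<zeta> \<noteq> \<eta> \<longrightarrow>
      br (\<lambda>x. \<Sum>i\<le>n. \<zeta> ^ i * u i x) (\<lambda>x. \<Sum>j\<le>n. \<eta> ^ j * w j x) x =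
        (\<Sum>i\<le>n. \<Sum>j\<le>n. \<zeta> ^ i * \<eta> ^ j * K i j)) \<longleftrightarrow>
    (\<forall>i j. br (u i) (w j) x = K i j)"
    (is "?gen \<longleftrightarrow> ?co")
proof -
  have br: "br (\<lambda>x. \<Sum>i\<le>n. \<zeta> ^ i * u i x) (\<lambda>x. \<Sum>j\<le>n. \<eta> ^ j * w j x) x =
      (\<Sum>i\<le>n. \<Sum>j\<le>n. \<zeta> ^ i * \<eta> ^ j * br (u i) (w j) x)" for \<zeta> \<eta>
    using poly by (simp add: bracket_double_lincomb[OF skew])
  show ?thesis
  proof
    assume ?co
    then show ?gen by (simp add: br)
  next
    assume gen: ?gen
    have eq: "br (u i) (w j) x - K i j = 0" if "i \<le> n" "j \<le> n" for i j
    proof (rule bivariate_coeffs_eq_0[OF _ that])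
      fix \<zeta> \<eta> :: complex assume "\<zeta> \<noteq> \<eta>"
      then show "(\<Sum>i\<le>n. \<Sum>j\<le>n. \<zeta> ^ i * \<eta> ^ j * (br (u i) (w j) x - K i j)) = 0"
        using gen unfolding br by (simp add: right_diff_distrib sum_subtractf)
    qed
    have "br (u i) (w j) x = K i j" for i j
    proof (cases "i > n \<or> j > n")
      case True
      then show ?thesis
        using zero bracket_const_left[OF skew poly(2)] bracket_const_right[OF skew poly(1)] by auto
    next
      case False
      then show ?thesis using eq[of i j] by simp
    qed
    then show ?co by blast
  qed
qed

text \<open>
  The relations hold for all indices, although the coefficients beyond the coordinates are the
  constants 0 and 1: the right-hand sides vanish there as well. Hence the Jacobi identity needs
  no case distinction on the range of the indices.
\<close>

definition coefficient_relations :: "nat \<Rightarrow> coord bracket \<Rightarrow> (coord \<Rightarrow> complex) \<Rightarrow> bool" where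
  "coefficient_relations g br x \<longleftrightarrow>
    (\<forall>i j. br (P_coeff g i) (P_coeff g j) x = 0) \<and>
    (\<forall>i j. br (R_coeff g i) (R_coeff g j) x = 0) \<and>
    (\<forall>i j. br (P_coeff g i) (Q_coeff g j) x = 2 * Q_coeff g (Suc (i + j)) x) \<and>
    (\<forall>i j. br (P_coeff g i) (R_coeff g j) x = - 2 * R_coeff g (Suc (i + j)) x) \<and>
    (\<forall>i j. br (Q_coeff g i) (Q_coeff g j) x =
      - 4 * ((if j = 0 then Q_coeff g i x else 0) - (if i = 0 then Q_coeff g j x else 0))) \<and>
    (\<forall>i j. br (Q_coeff g i) (R_coeff g j) x =
      4 * P_coeff g (Suc (i + j)) x - (if i = 0 then 4 * R_coeff g j x else 0))"

lemma lax_bracket_iff: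
  "lax_bracket g br \<longleftrightarrow> skew_biderivation (coords g) br \<and>
    (\<forall>x \<in> affine_space (coords g). coefficient_relations g br x)"
proof (cases "skew_biderivation (coords g) br")
  case skew: True
  have *: "(\<forall>\<zeta> \<eta>. \<zeta> \<noteq> \<eta> \<longrightarrow>
        br (P_at g \<zeta>) (P_at g \<eta>) x = 0 \<and>
        br (R_at g \<zeta>) (R_at g \<eta>) x = 0 \<and>
        br (P_at g \<zeta>) (Q_at g \<eta>) x = 2 * ((Q_at g \<zeta> x - Q_at g \<eta> x) / (\<zeta> - \<eta>)) \<and>
        br (P_at g \<zeta>) (R_at g \<eta>) x = - 2 * ((R_at g \<zeta> x - R_at g \<eta> x) / (\<zeta> - \<eta>)) \<and>
        br (Q_at g \<zeta>) (Q_at g \<eta>) x = - 4 * (Q_at g \<zeta> x - Q_at g \<eta> x) \<and>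
        br (Q_at g \<zeta>) (R_at g \<eta>) x =
          4 * ((P_at g \<zeta> x - P_at g \<eta> x) / (\<zeta> - \<eta>)) - 4 * R_at g \<eta> x) \<longleftrightarrow>
    coefficient_relations g br x" for x
  proof -
    let ?n = "Suc g"
    have quot: "(\<Sum>i\<le>?n. \<Sum>j\<le>?n. \<zeta> ^ i * \<eta> ^ j * (c * a (Suc (i + j)))) =
       c * (((\<Sum>k\<le>?n. \<zeta> ^ k * a k) - (\<Sum>k\<le>?n. \<eta> ^ k * a k)) / (\<zeta> - \<eta>))"
      if "\<zeta> \<noteq> \<eta>" "\<And>k. k > ?n \<Longrightarrow> a k = 0" for \<zeta> \<eta> c :: complex and a
    proof -
      have "(\<Sum>i\<le>?n. \<Sum>j\<le>?n. \<zeta> ^ i * \<eta> ^ j * (c * a (Suc (i + j)))) =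
          c * (\<Sum>i\<le>?n. \<Sum>j\<le>?n. \<zeta> ^ i * \<eta> ^ j * a (Suc (i + j)))"
        unfolding sum_distrib_left by (simp only: ac_simps)
      then show ?thesis
        using difference_quotient_sum[of ?n a, OF that(2,1)] by simp
    qed
    \<comment> \<open>A term that depends on \<eta> alone has its coefficients in the row
      \<open>i = 0\<close>. This is the source of the conditionals in
      \<open>coefficient_relations\<close>.\<close>
    have delta0: "(\<Sum>i\<le>?n. \<Sum>j\<le>?n. \<zeta> ^ i * \<eta> ^ j * (if i = 0 then a j else 0)) = (\<Sum>j\<le>?n. \<eta> ^ j * a j)"
      for \<zeta> \<eta> :: complex and a :: "nat \<Rightarrow> complex"
      by (subst sum.atMost_Suc_shift) simp
    have delta1: "(\<Sum>i\<le>?n. \<Sum>j\<le>?n. \<zeta> ^ i * \<eta> ^ j * (if j = 0 then a i else 0)) = (\<Sum>i\<le>?n. \<zeta> ^ i * a i)"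
      for \<zeta> \<eta> :: complex and a :: "nat \<Rightarrow> complex"
      by (subst sum.swap, subst sum.atMost_Suc_shift) simp
    note gen = generating_function_bracket_iff[OF skew, where n = ?n and x = x]
    have PP: "(\<forall>\<zeta> \<eta>. \<zeta> \<noteq> \<eta> \<longrightarrow> br (P_at g \<zeta>) (P_at g \<eta>) x = 0) \<longleftrightarrow>
       (\<forall>i j. br (P_coeff g i) (P_coeff g j) x = 0)"
      unfolding at_eq_sum
      by (subst gen[symmetric]) (auto simp: coeff_fun_polynomial const_coeff)
    have RR: "(\<forall>\<zeta> \<eta>. \<zeta> \<noteq> \<eta> \<longrightarrow> br (R_at g \<zeta>) (R_at g \<eta>) x = 0) \<longleftrightarrow>
       (\<forall>i j. br (R_coeff g i) (R_coeff g j) x = 0)"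
      unfolding at_eq_sum
      by (subst gen[symmetric]) (auto simp: coeff_fun_polynomial const_coeff)
    have quot_iff: "(\<forall>\<zeta> \<eta>. \<zeta> \<noteq> \<eta> \<longrightarrow>
        br (\<lambda>x. \<Sum>i\<le>?n. \<zeta> ^ i * u i x) (\<lambda>x. \<Sum>j\<le>?n. \<eta> ^ j * w j x) x =
          c * (((\<Sum>k\<le>?n. \<zeta> ^ k * a k x) - (\<Sum>k\<le>?n. \<eta> ^ k * a k x)) / (\<zeta> - \<eta>))) \<longleftrightarrow>
        (\<forall>i j. br (u i) (w j) x = c * a (Suc (i + j)) x)"
      if "\<And>i. u i \<in> polynomial_functions (coords g)" "\<And>j. w j \<in> polynomial_functions (coords g)"
        "\<And>i. i > ?n \<Longrightarrow> u i = (\<lambda>_. 0)" "\<And>j. j > ?n \<Longrightarrow> w j = (\<lambda>_. 0)"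
        "\<And>k. k > ?n \<Longrightarrow> a k = (\<lambda>_. 0)" for u w a c
      using that by (subst gen[symmetric]) (auto simp: quot[where a = "\<lambda>k. a k x"] simp del: sum.atMost_Suc)
    have PQ: "(\<forall>\<zeta> \<eta>. \<zeta> \<noteq> \<eta> \<longrightarrow>
        br (P_at g \<zeta>) (Q_at g \<eta>) x = 2 * ((Q_at g \<zeta> x - Q_at g \<eta> x) / (\<zeta> - \<eta>))) \<longleftrightarrow>
       (\<forall>i j. br (P_coeff g i) (Q_coeff g j) x = 2 * Q_coeff g (Suc (i + j)) x)"
      unfolding at_eq_sum by (rule quot_iff) (auto simp: coeff_fun_polynomial const_coeff)
    have PR: "(\<forall>\<zeta> \<eta>. \<zeta> \<noteq> \<eta> \<longrightarrow>
        br (P_at g \<zeta>) (R_at g \<eta>) x = - 2 * ((R_at g \<zeta> x - R_at g \<eta> x) / (\<zeta> - \<eta>))) \<longleftrightarrow>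
       (\<forall>i j. br (P_coeff g i) (R_coeff g j) x = - 2 * R_coeff g (Suc (i + j)) x)"
      unfolding at_eq_sum by (rule quot_iff) (auto simp: coeff_fun_polynomial const_coeff)
    have QQ: "(\<forall>\<zeta> \<eta>. \<zeta> \<noteq> \<eta> \<longrightarrow>
        br (Q_at g \<zeta>) (Q_at g \<eta>) x = - 4 * (Q_at g \<zeta> x - Q_at g \<eta> x)) \<longleftrightarrow>
       (\<forall>i j. br (Q_coeff g i) (Q_coeff g j) x =
         - 4 * ((if j = 0 then Q_coeff g i x else 0) - (if i = 0 then Q_coeff g j x else 0)))"
    proof -
      have "(\<Sum>i\<le>?n. \<Sum>j\<le>?n. \<zeta> ^ i * \<eta> ^ j *
          (- 4 * ((if j = 0 then Q_coeff g i x else 0) - (if i = 0 then Q_coeff g j x else 0)))) =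
        - 4 * ((\<Sum>i\<le>?n. \<Sum>j\<le>?n. \<zeta> ^ i * \<eta> ^ j * (if j = 0 then Q_coeff g i x else 0)) -
           (\<Sum>i\<le>?n. \<Sum>j\<le>?n. \<zeta> ^ i * \<eta> ^ j * (if i = 0 then Q_coeff g j x else 0)))" for \<zeta> \<eta>
        unfolding sum_subtractf[symmetric] sum_distrib_left by (intro sum.cong refl) (simp only: ring_distribs mult_ac)
      then show ?thesis
        unfolding at_eq_sum
        by (subst gen[symmetric]) (auto simp: coeff_fun_polynomial const_coeff delta0 delta1
             simp del: sum.atMost_Suc mult_minus_left)
    qed
    have QR: "(\<forall>\<zeta> \<eta>. \<zeta> \<noteq> \<eta> \<longrightarrow>
        br (Q_at g \<zeta>) (R_at g \<eta>) x =
          4 * ((P_at g \<zeta> x - P_at g \<eta> x) / (\<zeta> - \<eta>)) - 4 * R_at g \<eta> x) \<longleftrightarrow>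
       (\<forall>i j. br (Q_coeff g i) (R_coeff g j) x =
         4 * P_coeff g (Suc (i + j)) x - (if i = 0 then 4 * R_coeff g j x else 0))"
    proof -
      have "(\<Sum>i\<le>?n. \<Sum>j\<le>?n. \<zeta> ^ i * \<eta> ^ j *
          (4 * P_coeff g (Suc (i + j)) x - (if i = 0 then 4 * R_coeff g j x else 0))) =
        4 * (((\<Sum>k\<le>?n. \<zeta> ^ k * P_coeff g k x) - (\<Sum>k\<le>?n. \<eta> ^ k * P_coeff g k x)) / (\<zeta> - \<eta>)) -
          4 * (\<Sum>j\<le>?n. \<eta> ^ j * R_coeff g j x)" if "\<zeta> \<noteq> \<eta>" for \<zeta> \<eta>
      proof -
        have "4 * (\<Sum>j\<le>?n. \<eta> ^ j * R_coeff g j x) = (\<Sum>j\<le>?n. \<eta> ^ j * (4 * R_coeff g j x))"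
          by (simp only: sum_distrib_left mult.left_commute)
        moreover have "(\<Sum>i\<le>?n. \<Sum>j\<le>?n. \<zeta> ^ i * \<eta> ^ j * (4 * P_coeff g (Suc (i + j)) x)) =
          4 * (((\<Sum>k\<le>?n. \<zeta> ^ k * P_coeff g k x) - (\<Sum>k\<le>?n. \<eta> ^ k * P_coeff g k x)) / (\<zeta> - \<eta>))"
          using that by (rule quot) (simp add: const_coeff)
        ultimately show ?thesis
          by (simp only: right_diff_distrib sum_subtractf delta0)
      qed
      then show ?thesis
        unfolding at_eq_sum
        by (subst gen[symmetric])
          (auto simp: coeff_fun_polynomial const_coeff simp del: sum.atMost_Suc)
    qed
    show ?thesis
      unfolding coefficient_relations_def PP[symmetric] RR[symmetric] PQ[symmetric] PR[symmetric]
        QQ[symmetric] QR[symmetric] by (simp only: all_conj_distrib imp_conjR)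
  qed
  then show ?thesis
    unfolding lax_bracket_def using skew by simp
qed (simp add: lax_bracket_def)

section \<open>Jacobi identity, involution and Casimir functions\<close>

definition F_at :: "nat \<Rightarrow> complex \<Rightarrow> (coord \<Rightarrow> complex) \<Rightarrow> complex" where
  "F_at g \<zeta> = P_at g \<zeta> * P_at g \<zeta> + Q_at g \<zeta> * R_at g \<zeta>"

lemma degree_F_poly: "degree (F_poly g x) \<le> 2 * g + 2"
proof -
  have "degree ((P_poly g x)\<^sup>2) \<le> 2 * g + 2"
    using degree_power_le[of "P_poly g x" 2] by (simp add: degree_poly)
  moreover have "degree (Q_poly g x * R_poly g x) \<le> 2 * g + 2"
    using degree_mult_le[of "Q_poly g x" "R_poly g x"] degree_poly(2,3)[of g x] by simp
  ultimately show ?thesis by (simp add: F_poly_eq degree_add_le)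
qed

lemma hamiltonian_eq_0: "n > 2 * g + 2 \<Longrightarrow> hamiltonian g n = (\<lambda>_. 0)"
  by (rule ext) (simp add: hamiltonian_def coeff_eq_0 le_less_trans[OF degree_F_poly])

lemma F_at_eq_sum: "F_at g \<zeta> = (\<lambda>x. \<Sum>n\<le>2 * g + 2. \<zeta> ^ n * hamiltonian g n x)"
proof
  fix x
  have "F_at g \<zeta> x = poly (F_poly g x) \<zeta>"
    by (simp add: F_at_def F_poly_eq P_at_def Q_at_def R_at_def power2_eq_square)
  then show "F_at g \<zeta> x = (\<Sum>n\<le>2 * g + 2. \<zeta> ^ n * hamiltonian g n x)"
    by (simp add: poly_eq_sum_bound[OF degree_F_poly] hamiltonian_def del: sum.atMost_Suc)
qed

lemma hamiltonian_polynomial: "hamiltonian g n \<in> polynomial_functions (coords g)"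
proof -
  have "hamiltonian g n = (\<Sum>i\<le>n. P_coeff g i * P_coeff g (n - i) + Q_coeff g i * R_coeff g (n - i))"
    by (simp add: fun_eq_iff hamiltonian_def F_poly_eq power2_eq_square coeff_mult
        sum_fun_apply coeff_fun_defs sum.distrib)
  then show ?thesis
    by (auto intro!: polynomial_functions_sum polynomial_functions.add polynomial_functions.mult
        coeff_fun_polynomial)
qed

text \<open>Kept as a symbol so that the Jacobi identity needs no case split on zero indices; there
  it is unfolded only at successors, where it vanishes.\<close>

definition four_delta :: "nat \<Rightarrow> complex" where
  "four_delta i = (if i = 0 then 4 else 0)"

lemma F_at_polynomial: "F_at g \<zeta> \<in> polynomial_functions (coords g)"
  unfolding F_at_def
  by (intro polynomial_functions.add polynomial_functions.mult at_polynomial)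

context
  fixes g :: nat and br :: "coord bracket"
  assumes lax: "lax_bracket g br"
begin

lemma lax_skew: "skew_biderivation (coords g) br"
  using lax by (simp add: lax_bracket_def)

lemma bracket_eq_0_affineI:
  assumes "f \<in> polynomial_functions (coords g)" "h \<in> polynomial_functions (coords g)"
    and "\<And>x. x \<in> affine_space (coords g) \<Longrightarrow> br f h x = 0"
  shows "br f h = 0"
proof (rule polynomial_functions_eqI[OF bracket_polynomial[OF lax_skew assms(1,2)]])
  show "0 \<in> polynomial_functions (coords g)"
    unfolding zero_fun_def by (rule polynomial_functions.const)
qed (simp add: assms(3))

lemma bracket_lin2:
  assumes "f \<in> polynomial_functions (coords g)" "h \<in> polynomial_functions (coords g)"
    "k \<in> polynomial_functions (coords g)"
  shows "br (\<lambda>x. a * f x + b * h x) k = (\<lambda>x. a * br f k x + b * br h k x)"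
proof -
  have "(\<lambda>x. a * f x + b * h x) = (\<lambda>x. a * f x) + (\<lambda>x. b * h x)"
    by (simp add: fun_eq_iff)
  then have "br (\<lambda>x. a * f x + b * h x) k = br (\<lambda>x. a * f x) k + br (\<lambda>x. b * h x) k"
    using assms by (simp only: bracket_add_left[OF lax_skew] polynomial_functions_cmult)
  then show ?thesis
    using assms by (simp add: bracket_cmult_left[OF lax_skew] fun_eq_iff)
qed

text \<open>The right-hand sides are multiples or sums of the shape
  \<open>a * f x + b * h x\<close>, with signs absorbed into the scalars, to match
  \<open>bracket_lin2\<close> when they occur inside another bracket. Both orders of each mixed pair
  are listed, so that nested brackets can be evaluated by rewriting alone.\<close>

lemma coeff_brackets:
  "br (P_coeff g i) (P_coeff g j) = (\<lambda>x. 0)"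
  "br (R_coeff g i) (R_coeff g j) = (\<lambda>x. 0)"
  "br (P_coeff g i) (Q_coeff g j) = (\<lambda>x. 2 * Q_coeff g (Suc (i + j)) x)"
  "br (Q_coeff g j) (P_coeff g i) = (\<lambda>x. - 2 * Q_coeff g (Suc (i + j)) x)"
  "br (P_coeff g i) (R_coeff g j) = (\<lambda>x. - 2 * R_coeff g (Suc (i + j)) x)"
  "br (R_coeff g j) (P_coeff g i) = (\<lambda>x. 2 * R_coeff g (Suc (i + j)) x)"
  "br (Q_coeff g i) (Q_coeff g j) =
    (\<lambda>x. four_delta i * Q_coeff g j x + (- four_delta j) * Q_coeff g i x)"
  "br (Q_coeff g i) (R_coeff g j) =
    (\<lambda>x. 4 * P_coeff g (Suc (i + j)) x + (- four_delta i) * R_coeff g j x)"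
  "br (R_coeff g j) (Q_coeff g i) =
    (\<lambda>x. - 4 * P_coeff g (Suc (i + j)) x + four_delta i * R_coeff g j x)"
proof -
  have rel: "coefficient_relations g br x" if "x \<in> affine_space (coords g)" for x
    using lax that by (simp add: lax_bracket_iff)
  have eqI: "br f h = k"
    if "f \<in> polynomial_functions (coords g)" "h \<in> polynomial_functions (coords g)"
      "k \<in> polynomial_functions (coords g)"
      "\<And>x. coefficient_relations g br x \<Longrightarrow> br f h x = k x" for f h k
    by (rule polynomial_functions_eqI[OF bracket_polynomial[OF lax_skew that(1,2)] that(3)])
      (simp add: rel that(4))
  note poly = coeff_fun_polynomial polynomial_functions_lin2 polynomial_functions_cmult polynomial_functions.const
  show "br (P_coeff g i) (P_coeff g j) = (\<lambda>x. 0)"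
    by (rule eqI; (intro poly | simp add: coefficient_relations_def four_delta_def))
  show "br (R_coeff g i) (R_coeff g j) = (\<lambda>x. 0)"
    by (rule eqI; (intro poly | simp add: coefficient_relations_def four_delta_def))
  show pq: "br (P_coeff g i) (Q_coeff g j) = (\<lambda>x. 2 * Q_coeff g (Suc (i + j)) x)" for i j
    by (rule eqI; (intro poly | simp add: coefficient_relations_def four_delta_def))
  show pr: "br (P_coeff g i) (R_coeff g j) = (\<lambda>x. - 2 * R_coeff g (Suc (i + j)) x)" for i j
    by (rule eqI; (intro poly | simp add: coefficient_relations_def four_delta_def))
  show "br (Q_coeff g i) (Q_coeff g j) =
      (\<lambda>x. four_delta i * Q_coeff g j x + (- four_delta j) * Q_coeff g i x)"
    by (rule eqI; (intro poly | simp add: coefficient_relations_def four_delta_def))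
  show qr: "br (Q_coeff g i) (R_coeff g j) =
      (\<lambda>x. 4 * P_coeff g (Suc (i + j)) x + (- four_delta i) * R_coeff g j x)" for i j
    by (rule eqI; (intro poly | simp add: coefficient_relations_def four_delta_def))
  show "br (Q_coeff g j) (P_coeff g i) = (\<lambda>x. - 2 * Q_coeff g (Suc (i + j)) x)"
    "br (R_coeff g j) (P_coeff g i) = (\<lambda>x. 2 * R_coeff g (Suc (i + j)) x)"
    "br (R_coeff g j) (Q_coeff g i) =
      (\<lambda>x. - 4 * P_coeff g (Suc (i + j)) x + four_delta i * R_coeff g j x)"
    unfolding bracket_skew[OF lax_skew coeff_fun_polynomial(2) coeff_fun_polynomial(1)] pq
      bracket_skew[OF lax_skew coeff_fun_polynomial(3) coeff_fun_polynomial(1)] pr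
      bracket_skew[OF lax_skew coeff_fun_polynomial(3) coeff_fun_polynomial(2)] qr
    by (simp_all add: fun_eq_iff)
qed

lemma lax_poisson_bracket: "poisson_bracket (coords g) br"
proof (rule poisson_bracketI[OF lax_skew])
  fix a b c assume abc: "a \<in> coords g" "b \<in> coords g" "c \<in> coords g"
  let ?G = "range (P_coeff g) \<union> range (Q_coeff g) \<union> range (R_coeff g)"
  have coord: "(\<lambda>x. x d) \<in> ?G" if "d \<in> coords g" for d
    using that coord_coeff[of _ g, symmetric] by (auto simp: coords_def)
  have cm: "br (\<lambda>x. c * f x) k = (\<lambda>x. c * br f k x)"
    if "f \<in> polynomial_functions (coords g)" "k \<in> polynomial_functions (coords g)" for c f k
    using that by (rule bracket_cmult_left[OF lax_skew])
  have zero: "br (\<lambda>x. 0) k = (\<lambda>x. 0)" if "k \<in> polynomial_functions (coords g)" for k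
    using bracket_const_left[OF lax_skew that, of 0] by (simp add: zero_fun_def)
  \<comment> \<open>For each of the 27 choices of entries, two applications of the linear relations
    leave an identity that is linear in the coefficient functions.\<close>
  have "jacobiator br u v w = 0" if "u \<in> ?G" "v \<in> ?G" "w \<in> ?G" for u v w
    using that
    by (elim UnE rangeE)
      (simp_all only: jacobiator_def[OF lax_skew] coeff_brackets bracket_lin2 cm zero coeff_fun_polynomial,
        simp_all add: fun_eq_iff algebra_simps four_delta_def[of "Suc _"])
  from this[OF coord[OF abc(1)] coord[OF abc(2)] coord[OF abc(3)]]
  show "jacobiator br (\<lambda>x. x a) (\<lambda>x. x b) (\<lambda>x. x c) = 0"
    .
qed

section \<open>Lax equations for F and involution\<close>

lemma at_brackets:
  assumes "x \<in> affine_space (coords g)" "\<zeta> \<noteq> \<eta>"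
  shows "br (P_at g \<zeta>) (P_at g \<eta>) x = 0"
    "br (R_at g \<zeta>) (R_at g \<eta>) x = 0"
    "br (P_at g \<zeta>) (Q_at g \<eta>) x = 2 * ((Q_at g \<zeta> x - Q_at g \<eta> x) / (\<zeta> - \<eta>))"
    "br (Q_at g \<zeta>) (P_at g \<eta>) x = - 2 * ((Q_at g \<zeta> x - Q_at g \<eta> x) / (\<zeta> - \<eta>))"
    "br (P_at g \<zeta>) (R_at g \<eta>) x = - 2 * ((R_at g \<zeta> x - R_at g \<eta> x) / (\<zeta> - \<eta>))"
    "br (R_at g \<zeta>) (P_at g \<eta>) x = 2 * ((R_at g \<zeta> x - R_at g \<eta> x) / (\<zeta> - \<eta>))"
    "br (Q_at g \<zeta>) (Q_at g \<eta>) x = - 4 * (Q_at g \<zeta> x - Q_at g \<eta> x)"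
    "br (Q_at g \<zeta>) (R_at g \<eta>) x = 4 * ((P_at g \<zeta> x - P_at g \<eta> x) / (\<zeta> - \<eta>)) - 4 * R_at g \<eta> x"
    "br (R_at g \<zeta>) (Q_at g \<eta>) x = - 4 * ((P_at g \<zeta> x - P_at g \<eta> x) / (\<zeta> - \<eta>)) + 4 * R_at g \<zeta> x"
proof -
  have swap: "(a - b) / (\<eta> - \<zeta>) = (b - a) / (\<zeta> - \<eta>)" for a b
    by (metis minus_diff_eq minus_divide_divide)
  have sk: "br (Q_at g \<zeta>) (P_at g \<eta>) x = - br (P_at g \<eta>) (Q_at g \<zeta>) x"
    "br (R_at g \<zeta>) (P_at g \<eta>) x = - br (P_at g \<eta>) (R_at g \<zeta>) x"
    "br (R_at g \<zeta>) (Q_at g \<eta>) x = - br (Q_at g \<eta>) (R_at g \<zeta>) x"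
    by (subst bracket_skew[OF lax_skew], intro at_polynomial, intro at_polynomial, simp)+
  have rel: "br (P_at g \<zeta>) (P_at g \<eta>) x = 0 \<and>
        br (R_at g \<zeta>) (R_at g \<eta>) x = 0 \<and>
        br (P_at g \<zeta>) (Q_at g \<eta>) x = 2 * ((Q_at g \<zeta> x - Q_at g \<eta> x) / (\<zeta> - \<eta>)) \<and>
        br (P_at g \<zeta>) (R_at g \<eta>) x = - 2 * ((R_at g \<zeta> x - R_at g \<eta> x) / (\<zeta> - \<eta>)) \<and>
        br (Q_at g \<zeta>) (Q_at g \<eta>) x = - 4 * (Q_at g \<zeta> x - Q_at g \<eta> x) \<and>
        br (Q_at g \<zeta>) (R_at g \<eta>) x =
          4 * ((P_at g \<zeta> x - P_at g \<eta> x) / (\<zeta> - \<eta>)) - 4 * R_at g \<eta> x"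
    if "\<zeta> \<noteq> \<eta>" for \<zeta> \<eta>
    using lax assms(1) that unfolding lax_bracket_def by blast
  show "br (P_at g \<zeta>) (P_at g \<eta>) x = 0"
    "br (R_at g \<zeta>) (R_at g \<eta>) x = 0"
    "br (P_at g \<zeta>) (Q_at g \<eta>) x = 2 * ((Q_at g \<zeta> x - Q_at g \<eta> x) / (\<zeta> - \<eta>))"
    "br (P_at g \<zeta>) (R_at g \<eta>) x = - 2 * ((R_at g \<zeta> x - R_at g \<eta> x) / (\<zeta> - \<eta>))"
    "br (Q_at g \<zeta>) (Q_at g \<eta>) x = - 4 * (Q_at g \<zeta> x - Q_at g \<eta> x)"
    "br (Q_at g \<zeta>) (R_at g \<eta>) x = 4 * ((P_at g \<zeta> x - P_at g \<eta> x) / (\<zeta> - \<eta>)) - 4 * R_at g \<eta> x"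
    using rel[OF assms(2)] by blast+
  show "br (Q_at g \<zeta>) (P_at g \<eta>) x = - 2 * ((Q_at g \<zeta> x - Q_at g \<eta> x) / (\<zeta> - \<eta>))"
    "br (R_at g \<zeta>) (P_at g \<eta>) x = 2 * ((R_at g \<zeta> x - R_at g \<eta> x) / (\<zeta> - \<eta>))"
    "br (R_at g \<zeta>) (Q_at g \<eta>) x = - 4 * ((P_at g \<zeta> x - P_at g \<eta> x) / (\<zeta> - \<eta>)) + 4 * R_at g \<zeta> x"
    using rel[OF assms(2)[symmetric]] unfolding sk swap by (simp_all add: diff_divide_distrib)
qed

lemma bracket_F_at_left:
  assumes "h \<in> polynomial_functions (coords g)"
  shows "br (F_at g \<zeta>) h x = 2 * P_at g \<zeta> x * br (P_at g \<zeta>) h x +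
    Q_at g \<zeta> x * br (R_at g \<zeta>) h x + R_at g \<zeta> x * br (Q_at g \<zeta>) h x"
  unfolding F_at_def
  by (simp only: bracket_add_left[OF lax_skew] bracket_mult_left[OF lax_skew] polynomial_functions.mult
      at_polynomial assms) simp

text \<open>With L the Lax matrix and S = diag(1, -1), these are the entries of the Lax equation
  {F(\<zeta>), L(\<eta>)} = 2 [L(\<zeta>) / (\<zeta> - \<eta>) - R(\<zeta>) S, L(\<eta>)], cleared
  of denominators.\<close>

lemma bracket_F_at:
  assumes "x \<in> affine_space (coords g)" "\<zeta> \<noteq> \<eta>"
  shows "(\<zeta> - \<eta>) * br (F_at g \<zeta>) (P_at g \<eta>) x =
      2 * (R_at g \<zeta> x * Q_at g \<eta> x - Q_at g \<zeta> x * R_at g \<eta> x)"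
    "(\<zeta> - \<eta>) * br (F_at g \<zeta>) (Q_at g \<eta>) x =
      4 * (Q_at g \<zeta> x * P_at g \<eta> x - P_at g \<zeta> x * Q_at g \<eta> x) +
      4 * (\<zeta> - \<eta>) * R_at g \<zeta> x * Q_at g \<eta> x"
    "(\<zeta> - \<eta>) * br (F_at g \<zeta>) (R_at g \<eta>) x =
      4 * (P_at g \<zeta> x * R_at g \<eta> x - R_at g \<zeta> x * P_at g \<eta> x) -
      4 * (\<zeta> - \<eta>) * R_at g \<zeta> x * R_at g \<eta> x"
proof -
  define a where "a = (P_at g \<zeta> x - P_at g \<eta> x) / (\<zeta> - \<eta>)"
  define b where "b = (Q_at g \<zeta> x - Q_at g \<eta> x) / (\<zeta> - \<eta>)"
  define c where "c = (R_at g \<zeta> x - R_at g \<eta> x) / (\<zeta> - \<eta>)"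
  have abc: "(\<zeta> - \<eta>) * a = P_at g \<zeta> x - P_at g \<eta> x" "(\<zeta> - \<eta>) * b = Q_at g \<zeta> x - Q_at g \<eta> x"
    "(\<zeta> - \<eta>) * c = R_at g \<zeta> x - R_at g \<eta> x"
    using assms(2) by (simp_all add: a_def b_def c_def)
  \<comment> \<open>Here \<open>p\<close>, \<open>q\<close>, \<open>r\<close> are the entries at
    \<zeta>, while \<open>t\<close> becomes Q(\<zeta>) - Q(\<eta>) in the second identity and
    R(\<eta>) in the third. The factor \<zeta> - \<eta> is moved onto the quotients, where
    \<open>abc\<close> removes it.\<close>
  have alt: "(\<zeta> - \<eta>) * (2 * p * 0 + q * (2 * c) + r * (- 2 * b)) =
      2 * q * ((\<zeta> - \<eta>) * c) - 2 * r * ((\<zeta> - \<eta>) * b)"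
    "(\<zeta> - \<eta>) * (2 * p * (2 * b) + q * (- 4 * a + 4 * r) + r * (- 4 * t)) =
      4 * p * ((\<zeta> - \<eta>) * b) - 4 * q * ((\<zeta> - \<eta>) * a) + 4 * (\<zeta> - \<eta>) * r * (q - t)"
    "(\<zeta> - \<eta>) * (2 * p * (- 2 * c) + q * 0 + r * (4 * a - 4 * t)) =
      - 4 * p * ((\<zeta> - \<eta>) * c) + 4 * r * ((\<zeta> - \<eta>) * a) - 4 * (\<zeta> - \<eta>) * r * t" for p q r t
    by (simp_all add: algebra_simps)
  show "(\<zeta> - \<eta>) * br (F_at g \<zeta>) (P_at g \<eta>) x =
      2 * (R_at g \<zeta> x * Q_at g \<eta> x - Q_at g \<zeta> x * R_at g \<eta> x)"
    "(\<zeta> - \<eta>) * br (F_at g \<zeta>) (Q_at g \<eta>) x =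
      4 * (Q_at g \<zeta> x * P_at g \<eta> x - P_at g \<zeta> x * Q_at g \<eta> x) +
      4 * (\<zeta> - \<eta>) * R_at g \<zeta> x * Q_at g \<eta> x"
    "(\<zeta> - \<eta>) * br (F_at g \<zeta>) (R_at g \<eta>) x =
      4 * (P_at g \<zeta> x * R_at g \<eta> x - R_at g \<zeta> x * P_at g \<eta> x) -
      4 * (\<zeta> - \<eta>) * R_at g \<zeta> x * R_at g \<eta> x"
    unfolding bracket_F_at_left[OF at_polynomial(1)] bracket_F_at_left[OF at_polynomial(2)]
      bracket_F_at_left[OF at_polynomial(3)] at_brackets[OF assms] a_def[symmetric]
      b_def[symmetric] c_def[symmetric]
    by (simp_all only: alt abc) (simp_all add: algebra_simps)
qed

text \<open>The Lax equation moves L(\<eta>) by a commutator, and such a variation preserves the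
  determinant, which is - F(\<eta>).\<close>

lemma F_at_involution:
  assumes "x \<in> affine_space (coords g)" "\<zeta> \<noteq> \<eta>"
  shows "br (F_at g \<zeta>) (F_at g \<eta>) x = 0"
proof -
  have "br (F_at g \<zeta>) (F_at g \<eta>) x = 2 * P_at g \<eta> x * br (F_at g \<zeta>) (P_at g \<eta>) x +
      Q_at g \<eta> x * br (F_at g \<zeta>) (R_at g \<eta>) x + R_at g \<eta> x * br (F_at g \<zeta>) (Q_at g \<eta>) x"
    unfolding F_at_def[of g \<eta>]
    by (simp only: bracket_add_right[OF lax_skew] bracket_mult_right[OF lax_skew] polynomial_functions.mult
        at_polynomial F_at_polynomial) simp
  then have "(\<zeta> - \<eta>) * br (F_at g \<zeta>) (F_at g \<eta>) x =
      2 * P_at g \<eta> x * ((\<zeta> - \<eta>) * br (F_at g \<zeta>) (P_at g \<eta>) x) +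
      Q_at g \<eta> x * ((\<zeta> - \<eta>) * br (F_at g \<zeta>) (R_at g \<eta>) x) +
      R_at g \<eta> x * ((\<zeta> - \<eta>) * br (F_at g \<zeta>) (Q_at g \<eta>) x)"
    by (simp add: algebra_simps)
  also have "\<dots> = 0"
    unfolding bracket_F_at[OF assms] by (simp add: algebra_simps)
  finally show ?thesis using assms(2) by simp
qed

lemma hamiltonian_involution: "br (hamiltonian g i) (hamiltonian g j) = 0"
proof -
  have le: "br (hamiltonian g i) (hamiltonian g j) x = 0"
    if ij: "i \<le> 2 * g + 2" "j \<le> 2 * g + 2" and x: "x \<in> affine_space (coords g)" for i j x
  proof (rule bivariate_coeffs_eq_0[OF _ ij])
    fix \<zeta> \<eta> :: complex assume "\<zeta> \<noteq> \<eta>"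
    from F_at_involution[OF x this]
    show "(\<Sum>i\<le>2 * g + 2. \<Sum>j\<le>2 * g + 2. \<zeta> ^ i * \<eta> ^ j * br (hamiltonian g i) (hamiltonian g j) x) = 0"
      unfolding F_at_eq_sum
      by (simp only: bracket_double_lincomb[OF lax_skew] hamiltonian_polynomial)
  qed
  consider "i > 2 * g + 2" | "j > 2 * g + 2" | "i \<le> 2 * g + 2" "j \<le> 2 * g + 2" by linarith
  then show ?thesis
  proof cases
    case 1
    then show ?thesis by (simp only: hamiltonian_eq_0 bracket_const_left[OF lax_skew hamiltonian_polynomial])
  next
    case 2
    then show ?thesis by (simp only: hamiltonian_eq_0 bracket_const_right[OF lax_skew hamiltonian_polynomial])
  next
    case 3
    then show ?thesis
      by (intro bracket_eq_0_affineI hamiltonian_polynomial le)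
  qed
qed

text \<open>The factor \<open>\<zeta> - \<eta>\<close> pushes the degree in \<open>\<zeta>\<close> of the bracket with \<open>F(\<zeta>)\<close> below \<open>g\<close>.\<close>

lemma bracket_hamiltonian_eq_0_aux:
  assumes "h \<in> polynomial_functions (coords g)" "degree N \<le> g" "g \<le> n"
    and eq: "\<And>\<zeta>. \<zeta> \<noteq> \<eta> \<Longrightarrow> (\<zeta> - \<eta>) * br (F_at g \<zeta>) h x = poly N \<zeta>"
  shows "br (hamiltonian g n) h x = 0"
proof -
  define A where "A = (\<Sum>n\<le>2 * g + 2. monom (br (hamiltonian g n) h x) n)"
  have A: "poly A \<zeta> = br (F_at g \<zeta>) h x" for \<zeta>
    unfolding F_at_eq_sum using assms(1)
    by (simp add: A_def poly_sum poly_monom bracket_lincomb_left[OF lax_skew] hamiltonian_polynomial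
        mult.commute del: sum.atMost_Suc)
  have "[:- \<eta>, 1:] * A = N"
  proof (rule ccontr)
    assume "[:- \<eta>, 1:] * A \<noteq> N"
    then have "finite {\<zeta>. poly ([:- \<eta>, 1:] * A - N) \<zeta> = 0}"
      by (intro poly_roots_finite) simp
    moreover have "UNIV - {\<eta>} \<subseteq> {\<zeta>. poly ([:- \<eta>, 1:] * A - N) \<zeta> = 0}"
      using eq by (auto simp: A algebra_simps)
    ultimately show False
      using infinite_UNIV_char_0[where 'a=complex] by (meson finite.emptyI finite_Diff2 finite_insert finite_subset)
  qed
  then have "degree N = Suc (degree A)" if "A \<noteq> 0"
    using that by (metis degree_mult_eq degree_pCons_eq_if one_neq_zero pCons_eq_0_iff plus_1_eq_Suc
        degree_0 One_nat_def)
  then have "A = 0 \<or> degree A < g"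
    using assms(2) by (cases "A = 0") auto
  then have "coeff A n = 0"
    using assms(3) by (auto intro: coeff_eq_0)
  then have "n \<le> 2 * g + 2 \<Longrightarrow> ?thesis"
    by (simp add: A_def coeff_sum del: sum.atMost_Suc)
  moreover have "n > 2 * g + 2 \<Longrightarrow> ?thesis"
    by (simp add: hamiltonian_eq_0 bracket_const_left[OF lax_skew assms(1)])
  ultimately show ?thesis by linarith
qed

text \<open>For P both terms of the numerator have degree at most \<open>g\<close> in \<zeta>. For Q
  and R the terms of degree g + 1 cancel: the one from the monic P(\<zeta>) is opposite to the one
  from \<zeta> R(\<zeta>), which stems from the parts of the bracket that are not difference
  quotients.\<close>

lemma bracket_casimir_at:
  assumes "x \<in> affine_space (coords g)" "g \<le> n"
  shows "br (hamiltonian g n) (P_at g \<eta>) x = 0"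
    "br (hamiltonian g n) (Q_at g \<eta>) x = 0"
    "br (hamiltonian g n) (R_at g \<eta>) x = 0"
proof -
  let ?P = "P_poly g x" and ?Q = "Q_poly g x" and ?R = "R_poly g x"
  let ?p = "P_at g \<eta> x" and ?q = "Q_at g \<eta> x" and ?r = "R_at g \<eta> x"
  show "br (hamiltonian g n) (P_at g \<eta>) x = 0"
  proof (rule bracket_hamiltonian_eq_0_aux[where \<eta> = \<eta>, OF at_polynomial(1) _ assms(2)])
    show "degree (smult 2 (smult ?q ?R - smult ?r ?Q)) \<le> g"
      by (rule degree_le) (auto simp: coeff_Q_poly coeff_R_poly)
  qed (subst bracket_F_at(1)[OF assms(1)], assumption, simp add: P_at_def Q_at_def R_at_def algebra_simps)
  show "br (hamiltonian g n) (Q_at g \<eta>) x = 0"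
  proof (rule bracket_hamiltonian_eq_0_aux[where \<eta> = \<eta>, OF at_polynomial(2) _ assms(2)])
    show "degree (smult 4 (smult ?p ?Q - smult ?q ?P + pCons 0 (smult ?q ?R) - smult (\<eta> * ?q) ?R)) \<le> g"
      by (rule degree_le) (auto simp: coeff_P_poly coeff_Q_poly coeff_R_poly coeff_pCons split: nat.split)
  qed (subst bracket_F_at(2)[OF assms(1)], assumption, simp add: P_at_def Q_at_def R_at_def algebra_simps)
  show "br (hamiltonian g n) (R_at g \<eta>) x = 0"
  proof (rule bracket_hamiltonian_eq_0_aux[where \<eta> = \<eta>, OF at_polynomial(3) _ assms(2)])
    show "degree (smult 4 (smult ?r ?P - smult ?p ?R - pCons 0 (smult ?r ?R) + smult (\<eta> * ?r) ?R)) \<le> g"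
      by (rule degree_le) (auto simp: coeff_P_poly coeff_R_poly coeff_pCons split: nat.split)
  qed (subst bracket_F_at(3)[OF assms(1)], assumption, simp add: P_at_def Q_at_def R_at_def algebra_simps)
qed

text \<open>Vanishing against P, Q and R at every \<eta> passes to their coefficients, hence to the
  coordinates, and by the Leibniz rule to all polynomial functions.\<close>

lemma hamiltonian_casimir:
  assumes "g \<le> n" "f \<in> polynomial_functions (coords g)"
  shows "br (hamiltonian g n) f = 0"
proof -
  note ham = hamiltonian_polynomial[of g n]
  have coeff: "br (hamiltonian g n) (u i) x = 0"
    if u: "\<And>i. u i \<in> polynomial_functions (coords g)" and i: "i \<le> Suc g"
      and at: "\<And>\<eta>. br (hamiltonian g n) (\<lambda>x. \<Sum>i\<le>Suc g. \<eta> ^ i * u i x) x = 0" for u i x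
  proof -
    have "(\<Sum>i\<le>Suc g. br (hamiltonian g n) (u i) x * \<eta> ^ i) = 0" for \<eta>
      using at[of \<eta>] u
      by (simp add: bracket_lincomb_right[OF lax_skew ham] mult.commute del: sum.atMost_Suc)
    then show ?thesis
      using i polyfun_eq_0[where n = "Suc g" and c = "\<lambda>i. br (hamiltonian g n) (u i) x"] by blast
  qed
  have *: "br (hamiltonian g n) (\<lambda>x. x c) x = 0" if "c \<in> coords g" "x \<in> affine_space (coords g)" for c x
  proof -
    have "br (hamiltonian g n) (P_coeff g i) x = 0 \<and> br (hamiltonian g n) (Q_coeff g i) x = 0 \<and>
        br (hamiltonian g n) (R_coeff g i) x = 0" if "i \<le> Suc g" for i
      using coeff[of "P_coeff g", OF coeff_fun_polynomial(1) that, folded at_eq_sum]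
        coeff[of "Q_coeff g", OF coeff_fun_polynomial(2) that, folded at_eq_sum]
        coeff[of "R_coeff g", OF coeff_fun_polynomial(3) that, folded at_eq_sum]
        bracket_casimir_at[OF \<open>x \<in> _\<close> assms(1)]
      by blast
    then show ?thesis
      using that(1) by (auto simp: coords_def coord_coeff[symmetric])
  qed
  have "br f (hamiltonian g n) = 0"
  proof (rule bracket_eq_0I[OF lax_skew assms(2) ham])
    fix c assume c: "c \<in> coords g"
    note coord = polynomial_functions.coord[OF c]
    have "br (hamiltonian g n) (\<lambda>x. x c) = 0"
      by (rule bracket_eq_0_affineI[OF ham coord *[OF c]])
    then show "br (\<lambda>x. x c) (hamiltonian g n) = 0"
      using bracket_skew[OF lax_skew coord ham] by simp
  qed
  then show ?thesis
    using bracket_skew[OF lax_skew ham assms(2)] by simp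
qed

end

section \<open>Existence of the bracket\<close>

text \<open>The bracket of a bivector field with components \<open>w\<close>. The functions
  \<open>\<lambda>c. of_bool (c = a)\<close> are unit vectors, so both differentials are partial
  derivatives.\<close>

definition tensor_bracket :: "'i set \<Rightarrow> ('i \<Rightarrow> 'i \<Rightarrow> ('i \<Rightarrow> complex) \<Rightarrow> complex) \<Rightarrow> 'i bracket" where
  "tensor_bracket I w f h x = (\<Sum>a\<in>I. \<Sum>b\<in>I.
     differential f x (\<lambda>c. of_bool (c = a)) * differential h x (\<lambda>c. of_bool (c = b)) * w a b x)"

lemma tensor_bracket_coord:
  assumes "finite I" "a \<in> I" "b \<in> I"
  shows "tensor_bracket I w (\<lambda>x. x a) (\<lambda>x. x b) x = w a b x"
proof -
  have delta: "(\<Sum>d\<in>I. of_bool (c = d) * t d) = t c" if "c \<in> I" for c and t :: "'a \<Rightarrow> complex"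
    using assms(1) that by (simp add: of_bool_def if_distrib[of "\<lambda>u. u * _"] cong: if_cong)
  show ?thesis
    by (simp add: tensor_bracket_def mult.assoc sum_distrib_left[symmetric] delta assms)
qed

lemma skew_biderivation_tensor_bracket:
  assumes poly: "\<And>a b. a \<in> I \<Longrightarrow> b \<in> I \<Longrightarrow> w a b \<in> polynomial_functions I"
    and skew: "\<And>a b x. a \<in> I \<Longrightarrow> b \<in> I \<Longrightarrow> w a b x = - w b a x"
  shows "skew_biderivation I (tensor_bracket I w)"
proof -
  have "tensor_bracket I w f h \<in> polynomial_functions I"
    if "f \<in> polynomial_functions I" "h \<in> polynomial_functions I" for f h
  proof -
    have "tensor_bracket I w f h = (\<Sum>a\<in>I. \<Sum>b\<in>I. (\<lambda>x. differential f x (\<lambda>c. of_bool (c = a))) *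
        (\<lambda>x. differential h x (\<lambda>c. of_bool (c = b))) * w a b)"
      by (simp add: fun_eq_iff tensor_bracket_def sum_fun_apply)
    then show ?thesis
      using that poly
      by (auto intro!: polynomial_functions_sum polynomial_functions.mult differential_polynomial)
  qed
  moreover have "tensor_bracket I w f h = - tensor_bracket I w h f" for f h
  proof
    fix x
    have "tensor_bracket I w f h x = (\<Sum>a\<in>I. \<Sum>b\<in>I.
        - (differential h x (\<lambda>c. of_bool (c = b)) * differential f x (\<lambda>c. of_bool (c = a)) * w b a x))"
      unfolding tensor_bracket_def by (intro sum.cong refl, subst skew) simp_all
    also have "\<dots> = (- tensor_bracket I w h f) x"
      by (subst sum.swap) (simp add: tensor_bracket_def sum_negf)
    finally show "tensor_bracket I w f h x = (- tensor_bracket I w h f) x" .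
  qed
  moreover have "tensor_bracket I w (f + f') h = tensor_bracket I w f h + tensor_bracket I w f' h"
    if "f \<in> polynomial_functions I" "f' \<in> polynomial_functions I" for f f' h
    unfolding fun_eq_iff plus_fun_apply tensor_bracket_def differential_add[OF that]
    by (simp add: ring_distribs sum.distrib)
  moreover have "tensor_bracket I w (f * f') h = f * tensor_bracket I w f' h + f' * tensor_bracket I w f h"
    if "f \<in> polynomial_functions I" "f' \<in> polynomial_functions I" for f f' h
    unfolding fun_eq_iff plus_fun_apply times_fun_apply tensor_bracket_def differential_mult[OF that]
    by (simp add: ring_distribs sum.distrib sum_distrib_left mult.assoc)
  moreover have "tensor_bracket I w ((\<lambda>_. c) * f) h = (\<lambda>_. c) * tensor_bracket I w f h"
    if "f \<in> polynomial_functions I" for c f h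
    unfolding fun_eq_iff plus_fun_apply times_fun_apply tensor_bracket_def
      differential_mult[OF polynomial_functions.const that]
    by (simp add: sum_distrib_left mult.assoc)
  ultimately show ?thesis
    unfolding skew_biderivation_def by blast
qed

fun lax_tensor :: "nat \<Rightarrow> coord \<Rightarrow> coord \<Rightarrow> (coord \<Rightarrow> complex) \<Rightarrow> complex" where
  "lax_tensor g (CP i) (CP j) = (\<lambda>x. 0)"
| "lax_tensor g (CP i) (CQ j) = (\<lambda>x. 2 * Q_coeff g (Suc (i + j)) x)"
| "lax_tensor g (CP i) (CR j) = (\<lambda>x. - 2 * R_coeff g (Suc (i + j)) x)"
| "lax_tensor g (CQ j) (CP i) = (\<lambda>x. - 2 * Q_coeff g (Suc (i + j)) x)"
| "lax_tensor g (CQ i) (CQ j) =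
    (\<lambda>x. four_delta i * Q_coeff g j x + (- four_delta j) * Q_coeff g i x)"
| "lax_tensor g (CQ i) (CR j) = (\<lambda>x. 4 * P_coeff g (Suc (i + j)) x + (- four_delta i) * R_coeff g j x)"
| "lax_tensor g (CR j) (CP i) = (\<lambda>x. 2 * R_coeff g (Suc (i + j)) x)"
| "lax_tensor g (CR j) (CQ i) = (\<lambda>x. - 4 * P_coeff g (Suc (i + j)) x + four_delta i * R_coeff g j x)"
| "lax_tensor g (CR i) (CR j) = (\<lambda>x. 0)"

lemma finite_coords: "finite (coords g)"
  by (simp add: coords_def)

lemma lax_bracket_tensor: "lax_bracket g (tensor_bracket (coords g) (lax_tensor g))"
proof -
  let ?br = "tensor_bracket (coords g) (lax_tensor g)"
  note poly = coeff_fun_polynomial polynomial_functions_lin2 polynomial_functions_cmult polynomial_functions.const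
  have skew: "skew_biderivation (coords g) ?br"
  proof (rule skew_biderivation_tensor_bracket)
    fix a b :: coord
    show "lax_tensor g a b \<in> polynomial_functions (coords g)"
      by (cases a; cases b; simp only: lax_tensor.simps; intro poly)
    show "lax_tensor g a b x = - lax_tensor g b a x" for x
      by (cases "(g, a, b)" rule: lax_tensor.cases) simp_all
  qed
  have in_coords: "i \<le> g \<Longrightarrow> CP i \<in> coords g" "i \<le> g \<Longrightarrow> CQ i \<in> coords g" "i < g \<Longrightarrow> CR i \<in> coords g" for i
    by (auto simp: coords_def)
  have const: "(\<exists>c. P_coeff g i = (\<lambda>_. c))" if "\<not> i \<le> g" for i
    using that by (cases "i = Suc g") (auto simp: const_coeff)
  have constQ: "(\<exists>c. Q_coeff g i = (\<lambda>_. c))" if "\<not> i \<le> g" for i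
    using that by (auto simp: const_coeff)
  have constR: "(\<exists>c. R_coeff g i = (\<lambda>_. c))" if "\<not> i < g" for i
    using that by (cases "i = g") (auto simp: const_coeff)
  note const = const constQ constR
  have zero: "?br f h x = 0"
    if "f \<in> polynomial_functions (coords g)" "h \<in> polynomial_functions (coords g)"
      "(\<exists>c. f = (\<lambda>_. c)) \<or> (\<exists>c. h = (\<lambda>_. c))" for f h x
    using that(3) bracket_const_left[OF skew that(2)] bracket_const_right[OF skew that(1)]
    by (elim disjE exE) simp_all
  have "coefficient_relations g ?br x" for x
    unfolding coefficient_relations_def
  proof (intro conjI allI)
    fix i j
    show "?br (P_coeff g i) (P_coeff g j) x = 0"
    proof (cases "i \<le> g \<and> j \<le> g")
      case True
      then show ?thesis
        by (simp add: coord_coeff(1)[of i g] coord_coeff(1)[of j g] tensor_bracket_coord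
            finite_coords in_coords)
    next
      case False
      then have "?br (P_coeff g i) (P_coeff g j) x = 0"
        using const(1)[of i] const(1)[of j] by (intro zero coeff_fun_polynomial) blast
      then show ?thesis
        using False by (auto simp: coeff_fun_simps)
    qed
    show "?br (R_coeff g i) (R_coeff g j) x = 0"
    proof (cases "i < g \<and> j < g")
      case True
      then show ?thesis
        by (simp add: coord_coeff(3)[of i g] coord_coeff(3)[of j g] tensor_bracket_coord
            finite_coords in_coords)
    next
      case False
      then have "?br (R_coeff g i) (R_coeff g j) x = 0"
        using const(3)[of i] const(3)[of j] by (intro zero coeff_fun_polynomial) blast
      then show ?thesis
        using False by (auto simp: coeff_fun_simps)
    qed
    show "?br (P_coeff g i) (Q_coeff g j) x = 2 * Q_coeff g (Suc (i + j)) x"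
    proof (cases "i \<le> g \<and> j \<le> g")
      case True
      then show ?thesis
        by (simp add: coord_coeff(1)[of i g] coord_coeff(2)[of j g] tensor_bracket_coord
            finite_coords in_coords)
    next
      case False
      then have "?br (P_coeff g i) (Q_coeff g j) x = 0"
        using const(1)[of i] const(2)[of j] by (intro zero coeff_fun_polynomial) blast
      then show ?thesis
        using False by (auto simp: coeff_fun_simps)
    qed
    show "?br (P_coeff g i) (R_coeff g j) x = - 2 * R_coeff g (Suc (i + j)) x"
    proof (cases "i \<le> g \<and> j < g")
      case True
      then show ?thesis
        by (simp add: coord_coeff(1)[of i g] coord_coeff(3)[of j g] tensor_bracket_coord
            finite_coords in_coords)
    next
      case False
      then have "?br (P_coeff g i) (R_coeff g j) x = 0"
        using const(1)[of i] const(3)[of j] by (intro zero coeff_fun_polynomial) blast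
      then show ?thesis
        using False by (auto simp: coeff_fun_simps)
    qed
    show "?br (Q_coeff g i) (Q_coeff g j) x = - 4 * ((if j = 0 then Q_coeff g i x else 0) - (if i = 0 then Q_coeff g j x else 0))"
    proof (cases "i \<le> g \<and> j \<le> g")
      case True
      then show ?thesis
        by (simp add: coord_coeff(2)[of i g] coord_coeff(2)[of j g] coord_coeff(2)[of 0 g] tensor_bracket_coord
            finite_coords in_coords four_delta_def)
    next
      case False
      then have "?br (Q_coeff g i) (Q_coeff g j) x = 0"
        using const(2)[of i] const(2)[of j] by (intro zero coeff_fun_polynomial) blast
      then show ?thesis
        using False by (auto simp: coeff_fun_simps)
    qed
    show "?br (Q_coeff g i) (R_coeff g j) x = 4 * P_coeff g (Suc (i + j)) x - (if i = 0 then 4 * R_coeff g j x else 0)"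
    proof (cases "i \<le> g \<and> j < g")
      case True
      then show ?thesis
        by (simp add: coord_coeff(2)[of i g] coord_coeff(3)[of j g] tensor_bracket_coord
            finite_coords in_coords four_delta_def)
    next
      case False
      then have "?br (Q_coeff g i) (R_coeff g j) x = 0"
        using const(2)[of i] const(3)[of j] by (intro zero coeff_fun_polynomial) blast
      \<comment> \<open>At \<open>i = 0\<close>, \<open>j = g\<close> the two terms on the right do
        not vanish separately; they cancel because P and R are both monic.\<close>
      then show ?thesis
        using False by (auto simp: coeff_fun_simps)
    qed
  qed
  then show ?thesis
    by (simp add: lax_bracket_iff skew)
qed

section \<open>Symplectic leaves\<close>

context
  fixes I :: "'i set" and br :: "'i bracket"
  assumes skew_biderivation: "skew_biderivation I br"
begin

lemma symplectic_leaf_affine: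
  assumes "x \<in> affine_space I" "y \<in> symplectic_leaf I br x"
  shows "y \<in> affine_space I"
proof -
  have "(x, y) \<in> (hamiltonian_step I br)\<^sup>*"
    using assms(2) by (simp add: symplectic_leaf_def)
  then show ?thesis
    using assms(1) by (induction rule: rtrancl_induct) (auto simp: hamiltonian_step_def)
qed

text \<open>A \<open>hamiltonian_step\<close> lasts one unit of time, so the flow is rescaled: the
  curve \<open>\<lambda>s. \<gamma> (t * s)\<close> belongs to the Hamiltonian \<open>t * f\<close>,
  for negative \<open>t\<close> as well.\<close>

lemma hamiltonian_flow_in_leaf:
  assumes "f \<in> polynomial_functions I"
    and "\<And>t. \<gamma> t \<in> affine_space I"
    and deriv: "\<And>t i. ((\<lambda>s. \<gamma> s i) has_vector_derivative hamiltonian_field I br f (\<gamma> t) i) (at t)"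
    and "\<gamma> 0 \<in> symplectic_leaf I br x"
  shows "\<gamma> t \<in> symplectic_leaf I br x"
proof -
  let ?f = "\<lambda>x. of_real t * f x"
  have "(\<gamma> 0, \<gamma> t) \<in> hamiltonian_step I br"
    unfolding hamiltonian_step_def
  proof (intro CollectI case_prodI bexI[of _ ?f] exI[of _ "\<lambda>s. \<gamma> (t * s)"] conjI ballI allI)
    fix s i
    have "((\<lambda>s. \<gamma> (t * s) i) has_vector_derivative t *\<^sub>R hamiltonian_field I br f (\<gamma> (t * s)) i) (at s)"
    proof -
      have "((\<lambda>s. t * s) has_vector_derivative t) (at s)"
        by (auto intro!: derivative_eq_intros)
      from vector_diff_chain_at[OF this deriv[of i "t * s"]] show ?thesis
        by (simp add: o_def)
    qed
    also have "t *\<^sub>R hamiltonian_field I br f (\<gamma> (t * s)) i = hamiltonian_field I br ?f (\<gamma> (t * s)) i"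
      using assms(1)
      by (simp add: hamiltonian_field_def bracket_cmult_right[OF skew_biderivation]
          polynomial_functions.coord scaleR_conv_of_real)
    finally show "((\<lambda>s. \<gamma> (t * s) i) has_vector_derivative hamiltonian_field I br ?f (\<gamma> (t * s)) i)
        (at s within {0..1})"
      by (rule has_vector_derivative_at_within)
  qed (use assms(1,2) in \<open>auto intro: polynomial_functions_cmult\<close>)
  then show ?thesis
    using assms(4) by (auto simp: symplectic_leaf_def intro: rtrancl_into_rtrancl)
qed

text \<open>The flow line itself is the witness curve. Its velocity is continuous, being polynomial
  in the coordinates of a differentiable curve.\<close>

lemma hamiltonian_flow_tangent:
  assumes "f \<in> polynomial_functions I"
    and "\<And>t. \<gamma> t \<in> affine_space I"
    and deriv: "\<And>t i. ((\<lambda>s. \<gamma> s i) has_vector_derivative hamiltonian_field I br f (\<gamma> t) i) (at t)"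
    and "\<gamma> 0 \<in> symplectic_leaf I br x"
  shows "hamiltonian_field I br f (\<gamma> 0) \<in> tangent_vectors (symplectic_leaf I br x) (\<gamma> 0)"
  unfolding tangent_vectors_def
proof (rule CollectI, rule exI[of _ \<gamma>], rule exI[of _ "\<lambda>t. hamiltonian_field I br f (\<gamma> t)"],
    intro conjI ballI allI)
  show "continuous_on {-1<..<1} (\<lambda>t. hamiltonian_field I br f (\<gamma> t) i)" for i
  proof (cases "i \<in> I")
    case True
    then have "br (\<lambda>z. z i) f \<in> polynomial_functions I"
      using assms(1) by (intro bracket_polynomial[OF skew_biderivation] polynomial_functions.coord)
    from polynomial_function_has_vector_derivative[OF this deriv]
    have "continuous_on UNIV (\<lambda>t. br (\<lambda>z. z i) f (\<gamma> t))"
      by (auto intro!: continuous_at_imp_continuous_on has_vector_derivative_continuous)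
    then show ?thesis
      using True by (auto simp: hamiltonian_field_def intro: continuous_on_subset)
  qed (simp add: hamiltonian_field_def)
qed (use hamiltonian_flow_in_leaf[OF assms] deriv in auto)

text \<open>Along an integral curve of \<open>f\<close> the derivative of \<open>c\<close> is its
  bracket with \<open>f\<close>, which is zero; induction over the steps does the rest.\<close>

lemma casimir_constant_on_leaf:
  assumes "c \<in> polynomial_functions I" "\<And>f. f \<in> polynomial_functions I \<Longrightarrow> br c f = 0"
    and "y \<in> symplectic_leaf I br x"
  shows "c y = c x"
proof -
  have step: "c z = c y" if "(y, z) \<in> hamiltonian_step I br" for y z
  proof -
    from that obtain f \<gamma> where f: "f \<in> polynomial_functions I" and \<gamma>: "\<gamma> 0 = y" "\<gamma> 1 = z"
      and deriv: "\<And>t i. t \<in> {0..1} \<Longrightarrow> ((\<lambda>s. \<gamma> s i) has_vector_derivative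
        hamiltonian_field I br f (\<gamma> t) i) (at t within {0..1})"
      unfolding hamiltonian_step_def by blast
    have "((\<lambda>s. c (\<gamma> s)) has_vector_derivative 0) (at t within {0..1})" if "t \<in> {0..1}" for t
    proof -
      have "differential c (\<gamma> t) (hamiltonian_field I br f (\<gamma> t)) = 0"
        by (simp add: bracket_eq_differential[OF skew_biderivation assms(1) f, symmetric] assms(2)[OF f])
      moreover have "((\<lambda>s. c (\<gamma> s)) has_vector_derivative
          differential c (\<gamma> t) (hamiltonian_field I br f (\<gamma> t))) (at t within {0..1})"
        by (rule polynomial_function_has_vector_derivative[OF assms(1)]) (rule deriv[OF that])
      ultimately show ?thesis by simp
    qed
    then obtain k where "\<And>t. t \<in> {0..1} \<Longrightarrow> c (\<gamma> t) = k"
      using has_vector_derivative_zero_constant[of "{0..1}" "\<lambda>s. c (\<gamma> s)"]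
      by (metis convex_closed_interval box_real(2))
    then show ?thesis
      using \<gamma> by (metis atLeastAtMost_iff order_refl zero_le_one)
  qed
  have "(x, y) \<in> (hamiltonian_step I br)\<^sup>*"
    using assms(3) by (simp add: symplectic_leaf_def)
  then show ?thesis
    by (induction rule: rtrancl_induct) (auto dest: step)
qed

text \<open>Every curve inside the leaf keeps \<open>c\<close> constant, so the chain rule puts its
  velocity into the kernel. This is the upper bound for the tangent vectors, obtained without
  charts.\<close>

lemma tangent_vectors_casimir:
  assumes "c \<in> polynomial_functions I" "\<And>f. f \<in> polynomial_functions I \<Longrightarrow> br c f = 0"
    and "v \<in> tangent_vectors (symplectic_leaf I br x) y"
  shows "differential c y v = 0"
proof -
  from assms(3) obtain \<gamma> \<gamma>' where \<gamma>: "\<gamma> 0 = y" "\<gamma>' 0 = v"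
    and leaf: "\<And>t::real. t \<in> {-1<..<1} \<Longrightarrow> \<gamma> t \<in> symplectic_leaf I br x"
    and deriv: "\<And>i t. t \<in> {-1<..<1} \<Longrightarrow> ((\<lambda>s. \<gamma> s i) has_vector_derivative \<gamma>' t i) (at t)"
    unfolding tangent_vectors_def by blast
  have "((\<lambda>s. c (\<gamma> s)) has_vector_derivative differential c (\<gamma> 0) (\<gamma>' 0)) (at 0)"
    by (intro polynomial_function_has_vector_derivative[OF assms(1)] deriv) simp
  moreover have "((\<lambda>s. c (\<gamma> s)) has_vector_derivative 0) (at 0)"
  proof (rule has_vector_derivative_transform_within_open)
    show "((\<lambda>s::real. c x) has_vector_derivative 0) (at 0)" by simp
    show "c x = c (\<gamma> t)" if "t \<in> {-1<..<1}" for t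
      using casimir_constant_on_leaf[OF assms(1,2) leaf[OF that]] by simp
  qed auto
  ultimately show ?thesis
    using \<gamma> vector_derivative_unique_at by blast
qed

lemma tangent_vectors_affine:
  assumes "x \<in> affine_space I" "v \<in> tangent_vectors (symplectic_leaf I br x) y"
  shows "v \<in> affine_space I"
proof -
  from assms(2) obtain \<gamma> \<gamma>' where \<gamma>: "\<gamma> 0 = y" "\<gamma>' 0 = v"
    and leaf: "\<And>t::real. t \<in> {-1<..<1} \<Longrightarrow> \<gamma> t \<in> symplectic_leaf I br x"
    and deriv: "\<And>i t. t \<in> {-1<..<1} \<Longrightarrow> ((\<lambda>s. \<gamma> s i) has_vector_derivative \<gamma>' t i) (at t)"
    unfolding tangent_vectors_def by blast
  have "v i = 0" if "i \<notin> I" for i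
  proof -
    have "((\<lambda>s. \<gamma> s i) has_vector_derivative 0) (at 0)"
    proof (rule has_vector_derivative_transform_within_open)
      show "((\<lambda>s::real. 0::complex) has_vector_derivative 0) (at 0)" by simp
      show "0 = \<gamma> t i" if "t \<in> {-1<..<1}" for t
        using symplectic_leaf_affine[OF assms(1) leaf[OF that]] \<open>i \<notin> I\<close>
        by (simp add: affine_space_def)
    qed auto
    moreover have "((\<lambda>s. \<gamma> s i) has_vector_derivative v i) (at 0)"
      using deriv[of 0 i] \<gamma> by simp
    ultimately show ?thesis
      using vector_derivative_unique_at by blast
  qed
  then show ?thesis by (simp add: affine_space_def)
qed

end

section \<open>Flows of the coefficients of P and R\<close>

text \<open>The sum is the exponential of \<open>t * c\<close> times the shift by \<open>m\<close>,
  applied to \<open>a\<close>. Since \<open>a\<close> is zero beyond \<open>N\<close>, the shift is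
  nilpotent, and the last term on the right, which differentiation does not supply,
  vanishes.\<close>

lemma shift_exp_has_vector_derivative:
  fixes a :: "nat \<Rightarrow> complex"
  assumes "\<And>k. k > N \<Longrightarrow> a k = 0" "m > 0"
  shows "((\<lambda>t. \<Sum>n\<le>N. (of_real t * c) ^ n / fact n * a (i + n * m)) has_vector_derivative
    c * (\<Sum>n\<le>N. (of_real t * c) ^ n / fact n * a (i + m + n * m))) (at t)"
proof -
  have step: "((\<lambda>t. \<Sum>n\<le>N. (of_real t * c) ^ n / fact n * a (i + n * m)) has_vector_derivative
    c * (\<Sum>n<N. (of_real t * c) ^ n / fact n * a (i + m + n * m))) (at t)" for N
  proof (induction N)
    case (Suc N)
    have lin: "((\<lambda>t. of_real t * c) has_vector_derivative c) (at t)"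
      by (auto intro!: derivative_eq_intros)
    have "((\<lambda>z. z ^ Suc N / fact (Suc N) * a (i + Suc N * m)) has_field_derivative
        z ^ N / fact N * a (i + Suc N * m)) (at z)" for z :: complex
    proof -
      have "((\<lambda>z. a (i + Suc N * m) / fact (Suc N) * z ^ Suc N) has_field_derivative
          a (i + Suc N * m) / fact (Suc N) * (of_nat (Suc N) * z ^ N)) (at z)"
        by (intro DERIV_cmult, rule DERIV_power[OF DERIV_ident, THEN DERIV_cong])
          (simp del: of_nat_Suc)
      then show ?thesis
        by (simp add: fact_Suc field_simps del: of_nat_Suc power_Suc)
    qed
    from field_vector_diff_chain_at[OF lin this]
    have "((\<lambda>t. (of_real t * c) ^ Suc N / fact (Suc N) * a (i + Suc N * m)) has_vector_derivative
        c * ((of_real t * c) ^ N / fact N * a (i + m + N * m))) (at t)"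
      by (simp add: o_def ac_simps)
    from has_vector_derivative_add[OF Suc this] show ?case
      by (simp add: ring_distribs)
  qed simp
  have "a (i + m + N * m) = 0"
  proof (rule assms(1))
    have "N * 1 \<le> N * m" using assms(2) by (intro mult_le_mono2) simp
    then show "N < i + m + N * m" using assms(2) by linarith
  qed
  then show ?thesis
    using step[of N] by (simp add: lessThan_Suc_atMost[symmetric])
qed

text \<open>R is fixed, so P moves linearly in time; integrating the field on Q along this motion
  gives the quadratic term.\<close>

definition R_flow :: "nat \<Rightarrow> nat \<Rightarrow> (coord \<Rightarrow> complex) \<Rightarrow> real \<Rightarrow> coord \<Rightarrow> complex" where
  "R_flow g k y t c = (case c of
     CP i \<Rightarrow> if i \<le> g then P_coeff g i y - of_real t * (2 * R_coeff g (Suc (i + k)) y) else 0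
   | CQ i \<Rightarrow> if i \<le> g then Q_coeff g i y
        + of_real t * (4 * P_coeff g (Suc (i + k)) y - four_delta i * R_coeff g k y)
        - of_real t * of_real t * (4 * R_coeff g (Suc (Suc (i + k + k))) y) else 0
   | CR i \<Rightarrow> if i < g then R_coeff g i y else 0)"

text \<open>P is fixed, while the fields on Q and R are -2 and 2 times the index shift by
  \<open>Suc k\<close>. The sums are the exponentials of these nilpotent shifts.\<close>

definition P_flow :: "nat \<Rightarrow> nat \<Rightarrow> (coord \<Rightarrow> complex) \<Rightarrow> real \<Rightarrow> coord \<Rightarrow> complex" where
  "P_flow g k y t c = (case c of
     CP i \<Rightarrow> if i \<le> g then P_coeff g i y else 0
   | CQ i \<Rightarrow> if i \<le> g then \<Sum>n\<le>Suc g. (of_real t * (- 2)) ^ n / fact n * Q_coeff g (i + n * Suc k) y else 0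
   | CR i \<Rightarrow> if i < g then \<Sum>n\<le>Suc g. (of_real t * 2) ^ n / fact n * R_coeff g (i + n * Suc k) y else 0)"

lemma R_flow_coeff:
  "P_coeff g i (R_flow g k y t) = P_coeff g i y - of_real t * (2 * R_coeff g (Suc (i + k)) y)"
  "R_coeff g i (R_flow g k y t) = R_coeff g i y"
  by (auto simp: coeff_fun_simps R_flow_def)

lemma R_flow_0: "y \<in> affine_space (coords g) \<Longrightarrow> R_flow g k y 0 = y"
  by (auto simp: R_flow_def fun_eq_iff coeff_fun_simps affine_space_def coords_def split: coord.split)

lemma R_flow_affine: "R_flow g k y t \<in> affine_space (coords g)"
  by (auto simp: R_flow_def affine_space_def coords_def split: coord.split)

text \<open>Only the term \<open>n = 0\<close> survives at an index above which all coefficients are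
  zero. Hence the formulas of \<open>P_flow_coeff\<close> also hold for the coefficients that are
  constants.\<close>

lemma shift_exp_top:
  fixes a :: "nat \<Rightarrow> complex"
  assumes "\<And>k. k > i \<Longrightarrow> a k = 0"
  shows "(\<Sum>n\<le>N. z ^ n / fact n * a (i + n * Suc k)) = a i"
proof -
  have "(\<Sum>n\<le>N. z ^ n / fact n * a (i + n * Suc k)) = (\<Sum>n\<le>N. if n = 0 then a i else 0)"
    by (intro sum.cong refl) (auto simp: assms)
  then show ?thesis by simp
qed

lemma P_flow_coeff:
  "P_coeff g i (P_flow g k y t) = P_coeff g i y"
  "Q_coeff g i (P_flow g k y t) = (\<Sum>n\<le>Suc g. (of_real t * (- 2)) ^ n / fact n * Q_coeff g (i + n * Suc k) y)"
  "R_coeff g i (P_flow g k y t) = (\<Sum>n\<le>Suc g. (of_real t * 2) ^ n / fact n * R_coeff g (i + n * Suc k) y)"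
proof -
  show "P_coeff g i (P_flow g k y t) = P_coeff g i y"
    by (auto simp: coeff_fun_simps P_flow_def)
  show "Q_coeff g i (P_flow g k y t) = (\<Sum>n\<le>Suc g. (of_real t * (- 2)) ^ n / fact n * Q_coeff g (i + n * Suc k) y)"
  proof (cases "i \<le> g")
    case False
    then show ?thesis
      by (subst shift_exp_top) (auto simp: coeff_fun_simps)
  qed (simp add: coord_coeff P_flow_def)
  show "R_coeff g i (P_flow g k y t) = (\<Sum>n\<le>Suc g. (of_real t * 2) ^ n / fact n * R_coeff g (i + n * Suc k) y)"
  proof (cases "i < g")
    case False
    then show ?thesis
      by (subst shift_exp_top) (auto simp: coeff_fun_simps)
  qed (simp add: coord_coeff(3)[of i] P_flow_def)
qed

lemma P_flow_0: "y \<in> affine_space (coords g) \<Longrightarrow> P_flow g k y 0 = y"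
  by (auto simp: P_flow_def fun_eq_iff coeff_fun_simps affine_space_def coords_def power_0_left
      if_distrib[of "\<lambda>u. u / _"] if_distrib[of "\<lambda>u. u * _"] sum.delta
      simp del: sum.atMost_Suc split: coord.split cong: if_cong)

lemma P_flow_affine: "P_flow g k y t \<in> affine_space (coords g)"
  by (auto simp: P_flow_def affine_space_def coords_def split: coord.split)

context
  fixes g :: nat and br :: "coord bracket"
  assumes lax: "lax_bracket g br"
begin

lemma hamiltonian_field_coeff:
  "hamiltonian_field (coords g) br f y (CP i) = (if i \<le> g then br (P_coeff g i) f y else 0)"
  "hamiltonian_field (coords g) br f y (CQ i) = (if i \<le> g then br (Q_coeff g i) f y else 0)"
  "hamiltonian_field (coords g) br f y (CR i) = (if i < g then br (R_coeff g i) f y else 0)"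
  by (auto simp: hamiltonian_field_def coord_coeff coords_def)

lemma R_flow_deriv:
  "((\<lambda>t. R_flow g k y t c) has_vector_derivative
    hamiltonian_field (coords g) br (R_coeff g k) (R_flow g k y t) c) (at t)"
proof (cases c)
  case (CP i)
  then show ?thesis
    by (cases "i \<le> g")
      (auto simp: hamiltonian_field_coeff R_flow_def coeff_brackets[OF lax] R_flow_coeff
        intro!: derivative_eq_intros)
next
  case (CQ i)
  then show ?thesis
    by (cases "i \<le> g")
      (auto simp: hamiltonian_field_coeff R_flow_def coeff_brackets[OF lax] R_flow_coeff algebra_simps
        intro!: derivative_eq_intros)
next
  case (CR i)
  then show ?thesis
    by (cases "i < g")
      (auto simp: hamiltonian_field_coeff R_flow_def coeff_brackets[OF lax])
qed

lemma P_flow_deriv: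
  "((\<lambda>t. P_flow g k y t c) has_vector_derivative
    hamiltonian_field (coords g) br (P_coeff g k) (P_flow g k y t) c) (at t)"
proof (cases c)
  case (CP i)
  then show ?thesis
    by (cases "i \<le> g") (auto simp: hamiltonian_field_coeff P_flow_def coeff_brackets[OF lax])
next
  case (CQ i)
  show ?thesis
  proof (cases "i \<le> g")
    case True
    have "((\<lambda>t. \<Sum>n\<le>Suc g. (of_real t * (- 2)) ^ n / fact n * Q_coeff g (i + n * Suc k) y)
        has_vector_derivative - 2 *
          (\<Sum>n\<le>Suc g. (of_real t * (- 2)) ^ n / fact n * Q_coeff g (i + Suc k + n * Suc k) y)) (at t)"
      by (rule shift_exp_has_vector_derivative) (auto simp: const_coeff)
    moreover have "hamiltonian_field (coords g) br (P_coeff g k) (P_flow g k y t) c =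
        - 2 * Q_coeff g (i + Suc k) (P_flow g k y t)"
      using True CQ by (simp add: hamiltonian_field_coeff coeff_brackets[OF lax] add.commute)
    ultimately show ?thesis
      using True unfolding P_flow_coeff CQ by (simp add: P_flow_def del: sum.atMost_Suc)
  next
    case False
    then show ?thesis
      using CQ by (simp add: hamiltonian_field_coeff P_flow_def)
  qed
next
  case (CR i)
  show ?thesis
  proof (cases "i < g")
    case True
    have "((\<lambda>t. \<Sum>n\<le>Suc g. (of_real t * 2) ^ n / fact n * R_coeff g (i + n * Suc k) y)
        has_vector_derivative 2 *
          (\<Sum>n\<le>Suc g. (of_real t * 2) ^ n / fact n * R_coeff g (i + Suc k + n * Suc k) y)) (at t)"
      by (rule shift_exp_has_vector_derivative) (auto simp: const_coeff)
    moreover have "hamiltonian_field (coords g) br (P_coeff g k) (P_flow g k y t) c =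
        2 * R_coeff g (i + Suc k) (P_flow g k y t)"
      using True CR by (simp add: hamiltonian_field_coeff coeff_brackets[OF lax] add.commute)
    ultimately show ?thesis
      using True unfolding P_flow_coeff CR by (simp add: P_flow_def del: sum.atMost_Suc)
  next
    case False
    then show ?thesis
      using CR by (simp add: hamiltonian_field_coeff P_flow_def)
  qed
qed

lemma coeff_field_tangent:
  assumes "x \<in> affine_space (coords g)" "y \<in> symplectic_leaf (coords g) br x"
  shows "hamiltonian_field (coords g) br (P_coeff g k) y \<in> tangent_vectors (symplectic_leaf (coords g) br x) y"
    "hamiltonian_field (coords g) br (R_coeff g k) y \<in> tangent_vectors (symplectic_leaf (coords g) br x) y"
proof -
  note sk = lax_skew[OF lax]
  have y: "y \<in> affine_space (coords g)"
    using symplectic_leaf_affine[OF sk assms] .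
  show "hamiltonian_field (coords g) br (P_coeff g k) y \<in> tangent_vectors (symplectic_leaf (coords g) br x) y"
    using hamiltonian_flow_tangent[OF sk coeff_fun_polynomial(1), of "P_flow g k y" k x,
        OF P_flow_affine P_flow_deriv] assms(2)
    by (simp add: P_flow_0[OF y])
  show "hamiltonian_field (coords g) br (R_coeff g k) y \<in> tangent_vectors (symplectic_leaf (coords g) br x) y"
    using hamiltonian_flow_tangent[OF sk coeff_fun_polynomial(3), of "R_flow g k y" k x,
        OF R_flow_affine R_flow_deriv] assms(2)
    by (simp add: R_flow_0[OF y])
qed

lemma R_flow_in_leaf:
  assumes "x \<in> affine_space (coords g)" "y \<in> symplectic_leaf (coords g) br x"
  shows "R_flow g k y t \<in> symplectic_leaf (coords g) br x"
  by (rule hamiltonian_flow_in_leaf[OF lax_skew[OF lax] coeff_fun_polynomial(3) R_flow_affine R_flow_deriv])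
    (use assms in \<open>simp add: R_flow_0 symplectic_leaf_affine[OF lax_skew[OF lax]]\<close>)

end

section \<open>Tangent spaces of the leaves\<close>

lemma cfun_independent_family:
  fixes B :: "nat \<Rightarrow> 'i \<Rightarrow> complex"
  assumes ind: "\<And>c. (\<And>i. (\<Sum>m<n. c m * B m i) = 0) \<Longrightarrow> \<forall>m<n. c m = 0"
  shows "inj_on B {..<n}" "cfun.independent (B ` {..<n})"
proof -
  show inj: "inj_on B {..<n}"
  proof (rule inj_onI, rule ccontr)
    fix k l assume kl: "k \<in> {..<n}" "l \<in> {..<n}" "B k = B l" "k \<noteq> l"
    \<comment> \<open>Two equal members of the family would be related with coefficients 1 and
      -1.\<close>
    let ?c = "\<lambda>m. if m = k then 1 else if m = l then - 1 else (0::complex)"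
    have "(\<Sum>m<n. ?c m * B m i) = 0" for i
    proof -
      have "(\<Sum>m<n. ?c m * B m i) = (\<Sum>m\<in>{k, l}. ?c m * B m i)"
        using kl by (intro sum.mono_neutral_right) auto
      then show ?thesis using kl by simp
    qed
    from ind[OF this] kl show False by auto
  qed
  show "cfun.independent (B ` {..<n})"
  proof (rule cfun.independent_if_scalars_zero)
    fix u w assume u: "(\<Sum>v\<in>B ` {..<n}. cscale (u v) v) = 0" and w: "w \<in> B ` {..<n}"
    have "(\<Sum>m<n. u (B m) * B m i) = 0" for i
    proof -
      have "(\<Sum>v\<in>B ` {..<n}. cscale (u v) v) i = 0"
        using u by simp
      then show ?thesis
        by (simp add: sum_fun_apply sum.reindex[OF inj] cscale_def)
    qed
    from ind[OF this] w show "u w = 0" by auto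
  qed simp
qed

text \<open>The Hankel matrix with entries \<open>r (Suc (i + k))\<close> has ones on the
  antidiagonal and zeros below it. Solving from the bottom row upwards, each row determines one more
  unknown.\<close>

lemma anti_triangular_solve:
  fixes r :: "nat \<Rightarrow> complex"
  assumes "r g = 1" "\<And>m. m > g \<Longrightarrow> r m = 0"
  shows "\<exists>b. \<forall>i<g. (\<Sum>k<g. b k * r (Suc (i + k))) = w i"
proof -
  have "\<exists>b. \<forall>i<g. g \<le> i + n \<longrightarrow> (\<Sum>k<n. b k * r (Suc (i + k))) = w i" if "n \<le> g" for n
    using that
  proof (induction n)
    case (Suc n)
    then obtain b where b: "\<And>i. i < g \<Longrightarrow> g \<le> i + n \<Longrightarrow> (\<Sum>k<n. b k * r (Suc (i + k))) = w i"
      by auto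
    \<comment> \<open>This is the only new row. The unknown \<open>b n\<close> enters it with the
      coefficient \<open>r g = 1\<close>, and enters the rows below with coefficient zero.\<close>
    let ?i = "g - Suc n"
    define d where "d = b(n := w ?i - (\<Sum>k<n. b k * r (Suc (?i + k))))"
    have "(\<Sum>k<Suc n. d k * r (Suc (i + k))) = w i" if i: "i < g" "g \<le> i + Suc n" for i
    proof -
      have eq: "(\<Sum>k<n. d k * r (Suc (i + k))) = (\<Sum>k<n. b k * r (Suc (i + k)))"
        by (intro sum.cong) (auto simp: d_def)
      show ?thesis
      proof (cases "g \<le> i + n")
        case True
        then show ?thesis using b[OF i(1) True] assms(2)[of "Suc (i + n)"] by (simp add: eq)
      next
        case False
        then have "i = ?i" "Suc (i + n) = g" using i by auto
        then show ?thesis using assms(1) by (simp add: eq) (simp add: d_def)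
      qed
    qed
    then show ?case by blast
  qed simp
  from this[of g] show ?thesis by auto
qed

lemma anti_triangular_unique:
  fixes r :: "nat \<Rightarrow> complex"
  assumes "r g = 1" "\<And>m. m > g \<Longrightarrow> r m = 0"
    and zero: "\<And>i. i < g \<Longrightarrow> (\<Sum>k<g. b k * r (Suc (i + k))) = 0"
  shows "\<forall>k<g. b k = 0"
proof -
  have "k < g \<Longrightarrow> b k = 0" for k
  proof (induction k rule: less_induct)
    case (less k)
    \<comment> \<open>This row contains no unknown beyond \<open>b k\<close>, whose coefficient is
      1.\<close>
    let ?i = "g - Suc k"
    have "(\<Sum>l<g. b l * r (Suc (?i + l))) = (\<Sum>l\<in>{k}. b l * r (Suc (?i + l)))"
    proof (rule sum.mono_neutral_right)
      show "\<forall>l\<in>{..<g} - {k}. b l * r (Suc (?i + l)) = 0"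
      proof
        fix l assume l: "l \<in> {..<g} - {k}"
        show "b l * r (Suc (?i + l)) = 0"
        proof (cases "l < k")
          case True
          then show ?thesis using less.IH l by simp
        next
          case False
          then have "g < Suc (?i + l)" using l less.prems by auto
          then show ?thesis by (simp only: assms(2) mult_zero_right)
        qed
      qed
    qed (use less.prems in auto)
    then show ?case
      using zero[of ?i] less.prems assms(1) by simp
  qed
  then show ?thesis by blast
qed

text \<open>The variation of P in direction \<open>v\<close>; the fixed leading term drops out. Q
  has no fixed coefficient, so \<open>Q_poly\<close> serves as its own variation.\<close>

definition dP_poly :: "nat \<Rightarrow> (coord \<Rightarrow> complex) \<Rightarrow> complex poly" where
  "dP_poly g v = (\<Sum>i\<le>g. monom (v (CP i)) i)"

definition dR_poly :: "nat \<Rightarrow> (coord \<Rightarrow> complex) \<Rightarrow> complex poly" where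
  "dR_poly g v = (\<Sum>i<g. monom (v (CR i)) i)"

lemma coeff_dP_poly: "coeff (dP_poly g v) i = (if i \<le> g then v (CP i) else 0)"
  by (auto simp: dP_poly_def coeff_sum)

lemma coeff_dR_poly: "coeff (dR_poly g v) i = (if i < g then v (CR i) else 0)"
  by (auto simp: dR_poly_def coeff_sum)

lemma differential_hamiltonian:
  "differential (hamiltonian g n) y v =
    coeff (2 * P_poly g y * dP_poly g v + Q_poly g y * dR_poly g v + R_poly g y * Q_poly g v) n"
proof -
  \<comment> \<open>On a line through \<open>y\<close> the polynomial F is quadratic in the
    parameter; \<open>?D\<close> and \<open>?E\<close> are its linear and quadratic parts.\<close>
  let ?D = "2 * P_poly g y * dP_poly g v + Q_poly g y * dR_poly g v + R_poly g y * Q_poly g v"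
  let ?E = "dP_poly g v * dP_poly g v + Q_poly g v * dR_poly g v"
  have lin: "P_poly g (y + cscale t v) = P_poly g y + smult t (dP_poly g v)"
    "Q_poly g (y + cscale t v) = Q_poly g y + smult t (Q_poly g v)"
    "R_poly g (y + cscale t v) = R_poly g y + smult t (dR_poly g v)" for t
    by (auto simp: poly_eq_iff coeff_P_poly coeff_Q_poly coeff_R_poly coeff_dP_poly coeff_dR_poly cscale_def)
  have "F_poly g (y + cscale t v) = F_poly g y + smult t ?D + smult (t * t) ?E" for t
    unfolding F_poly_eq lin
    by (simp add: power2_eq_square algebra_simps smult_add_right mult_smult_left mult_smult_right numeral_poly)
  then have "(\<lambda>t. hamiltonian g n (y + cscale t v)) =
      (\<lambda>t. coeff (F_poly g y) n + t * coeff ?D n + t * t * coeff ?E n)"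
    by (simp add: fun_eq_iff hamiltonian_def)
  moreover have "((\<lambda>t. coeff (F_poly g y) n + t * coeff ?D n + t * t * coeff ?E n)
      has_field_derivative coeff ?D n) (at 0)"
    by (rule derivative_eq_intros refl | simp)+
  ultimately show ?thesis
    unfolding differential_def by (simp only: DERIV_imp_deriv)
qed

lemma differential_diff:
  assumes "f \<in> polynomial_functions I"
  shows "differential f x (\<lambda>i. v i - w i) = differential f x v - differential f x w"
  using differential_lincomb[OF assms, where K = UNIV and c = "\<lambda>b. if b then 1 else -1"
      and v = "\<lambda>b. if b then v else w"]
  by (simp add: UNIV_bool)

text \<open>The component along Q is recovered from those along P and R because R is monic.\<close>

lemma casimir_kernel_eq_0:
  assumes "v \<in> affine_space (coords g)"
    and ker: "\<And>n. g \<le> n \<Longrightarrow> differential (hamiltonian g n) y v = 0"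
    and "\<And>i. i < g \<Longrightarrow> v (CP i) = 0" "\<And>i. i < g \<Longrightarrow> v (CR i) = 0"
  shows "v = (\<lambda>_. 0)"
proof -
  have dR: "dR_poly g v = 0"
    using assms(4) by (auto simp: poly_eq_iff coeff_dR_poly)
  have dP: "dP_poly g v = monom (v (CP g)) g"
    using assms(3) by (auto simp: poly_eq_iff coeff_dP_poly)
  have RQ: "degree (R_poly g y * Q_poly g v) \<le> 2 * g"
    using degree_mult_le[of "R_poly g y" "Q_poly g v"] degree_poly(2,3)[of g] by (metis add_mono mult_2 order_refl order_trans)
  \<comment> \<open>Degree 2g + 1 isolates the remaining coefficient of dP, because R dQ does not
    reach that degree.\<close>
  have "coeff (2 * P_poly g y * monom (v (CP g)) g) (Suc g + g) = 2 * v (CP g)"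
    by (simp add: mult.commute[of _ "monom _ _"] coeff_monom_mult numeral_poly coeff_P_poly)
  moreover have "coeff (R_poly g y * Q_poly g v) (Suc g + g) = 0"
    using RQ by (intro coeff_eq_0) simp
  ultimately have CPg: "v (CP g) = 0"
    using ker[of "Suc g + g"] by (simp add: differential_hamiltonian dR dP)
  \<comment> \<open>If dQ were nonzero, R dQ would have degree at least \<open>g\<close>, so its
    leading coefficient would be one of those that \<open>ker\<close> forces to vanish.\<close>
  have "Q_poly g v = 0"
  proof (rule ccontr)
    assume nz: "Q_poly g v \<noteq> 0"
    have "R_poly g y \<noteq> 0"
      using coeff_R_poly[of g y g] by auto
    then have deg: "degree (R_poly g y * Q_poly g v) = g + degree (Q_poly g v)"
      and nz': "R_poly g y * Q_poly g v \<noteq> 0"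
      using nz by (simp_all add: degree_mult_eq degree_poly)
    have "coeff (R_poly g y * Q_poly g v) (degree (R_poly g y * Q_poly g v)) = 0"
      using ker[of "degree (R_poly g y * Q_poly g v)"]
      by (simp add: differential_hamiltonian dR dP CPg deg)
    then show False using nz' by simp
  qed
  then have CQ: "v (CQ i) = 0" if "i \<le> g" for i
    using coeff_Q_poly[of g v i] that by simp
  have CP: "v (CP i) = 0" if "i \<le> g" for i
    using assms(3)[of i] CPg that by (cases "i = g") auto
  show ?thesis
  proof
    fix c show "v c = 0"
      using assms(1) CP CQ assms(4) by (cases "c \<in> coords g") (auto simp: affine_space_def coords_def)
  qed
qed

section \<open>The frame of Hamiltonian fields and the dimension of the leaves\<close>

context
  fixes g :: nat and br :: "coord bracket"
  assumes lax: "lax_bracket g br"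
begin

abbreviation leaf where "leaf \<equiv> symplectic_leaf (coords g) br"

text \<open>The coefficient of P of degree \<open>g\<close> is left out: it is half of the Casimir
  function c_(2g+1), and its field is zero.\<close>

definition leaf_frame :: "(coord \<Rightarrow> complex) \<Rightarrow> nat \<Rightarrow> coord \<Rightarrow> complex" where
  "leaf_frame y m = hamiltonian_field (coords g) br
     (if m < g then R_coeff g m else P_coeff g (m - g)) y"

lemma leaf_frame_sum:
  "(\<Sum>m<2 * g. c m * leaf_frame y m i) =
    (\<Sum>k<g. c k * hamiltonian_field (coords g) br (R_coeff g k) y i) +
    (\<Sum>k<g. c (g + k) * hamiltonian_field (coords g) br (P_coeff g k) y i)"
proof -
  have "(\<Sum>m<g + n. f m) = (\<Sum>m<g. f m) + (\<Sum>k<n. f (g + k))" for f :: "nat \<Rightarrow> complex" and n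
    by (induction n) (simp_all add: add.assoc)
  from this[where n = g] show ?thesis
    by (simp add: mult_2 leaf_frame_def)
qed

text \<open>Fields of P coefficients move R but not P, and fields of R coefficients move P but not
  R. The frame therefore splits into two Hankel systems with the same matrix up to scalars, here and
  in \<open>leaf_frame_sum_CP\<close>.\<close>

lemma leaf_frame_sum_CR:
  "i < g \<Longrightarrow> (\<Sum>m<2 * g. c m * leaf_frame y m (CR i)) =
    2 * (\<Sum>k<g. c (g + k) * R_coeff g (Suc (i + k)) y)"
  unfolding leaf_frame_sum
  by (simp add: hamiltonian_field_coeff[OF lax] coeff_brackets[OF lax] sum_distrib_left ac_simps)

lemma leaf_frame_sum_CP:
  "i \<le> g \<Longrightarrow> (\<Sum>m<2 * g. c m * leaf_frame y m (CP i)) =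
    - 2 * (\<Sum>k<g. c k * R_coeff g (Suc (i + k)) y)"
  unfolding leaf_frame_sum
  by (simp add: hamiltonian_field_coeff[OF lax] coeff_brackets[OF lax] sum_distrib_left ac_simps)

lemma R_coeff_top: "R_coeff g g y = 1" "m > g \<Longrightarrow> R_coeff g m y = 0"
  by (simp_all add: const_coeff)

lemma leaf_frame_tangent:
  assumes "x \<in> affine_space (coords g)" "y \<in> leaf x"
  shows "leaf_frame y m \<in> tangent_vectors (leaf x) y"
  using coeff_field_tangent[OF lax assms] by (simp add: leaf_frame_def)

lemma leaf_frame_independent:
  assumes "\<And>i. (\<Sum>m<2 * g. c m * leaf_frame y m i) = 0"
  shows "\<forall>m<2 * g. c m = 0"
proof -
  have "\<forall>k<g. c k = 0"
    using assms leaf_frame_sum_CP[of _ c y]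
    by (intro anti_triangular_unique[where r = "\<lambda>m. R_coeff g m y"]) (auto simp: R_coeff_top)
  moreover have "\<forall>k<g. c (g + k) = 0"
    using assms leaf_frame_sum_CR[of _ c y]
    by (intro anti_triangular_unique[where r = "\<lambda>m. R_coeff g m y"]) (auto simp: R_coeff_top)
  ultimately show ?thesis
    by (metis add_diff_inverse_nat add_less_cancel_left mult_2)
qed

lemma differential_casimir_field:
  assumes "g \<le> n" "f \<in> polynomial_functions (coords g)"
  shows "differential (hamiltonian g n) y (hamiltonian_field (coords g) br f y) = 0"
  using bracket_eq_differential[OF lax_skew[OF lax] hamiltonian_polynomial assms(2), symmetric]
  by (simp add: hamiltonian_casimir[OF lax assms])

lemma casimir_kernel_span:
  assumes v: "v \<in> affine_space (coords g)"
    and ker: "\<And>n. g \<le> n \<Longrightarrow> differential (hamiltonian g n) y v = 0"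
  obtains c where "v = (\<lambda>i. \<Sum>m<2 * g. c m * leaf_frame y m i)"
proof -
  \<comment> \<open>The factors -1/2 and 1/2 undo the constants -2 and 2 in
    \<open>leaf_frame_sum_CP\<close> and \<open>leaf_frame_sum_CR\<close>.\<close>
  obtain a where a: "\<And>i. i < g \<Longrightarrow> (\<Sum>k<g. a k * R_coeff g (Suc (i + k)) y) = - v (CP i) / 2"
    using anti_triangular_solve[where r = "\<lambda>m. R_coeff g m y" and w = "\<lambda>i. - v (CP i) / 2",
        OF R_coeff_top] by blast
  obtain b where b: "\<And>i. i < g \<Longrightarrow> (\<Sum>k<g. b k * R_coeff g (Suc (i + k)) y) = v (CR i) / 2"
    using anti_triangular_solve[where r = "\<lambda>m. R_coeff g m y" and w = "\<lambda>i. v (CR i) / 2",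
        OF R_coeff_top] by blast
  define c where "c m = (if m < g then a m else b (m - g))" for m
  define w where "w = (\<lambda>i. \<Sum>m<2 * g. c m * leaf_frame y m i)"
  \<comment> \<open>By the choice of \<open>c\<close>, \<open>w\<close> agrees with \<open>v\<close>
    in the 2g coordinates that determine a vector of the kernel.\<close>
  have "(\<lambda>i. v i - w i) = (\<lambda>_. 0)"
  proof (rule casimir_kernel_eq_0)
    show "(\<lambda>i. v i - w i) \<in> affine_space (coords g)"
      using v by (simp add: affine_space_def w_def leaf_frame_def hamiltonian_field_def)
    show "differential (hamiltonian g n) y (\<lambda>i. v i - w i) = 0" if "g \<le> n" for n
      by (simp add: differential_diff[OF hamiltonian_polynomial] ker[OF that] w_def
          differential_lincomb[OF hamiltonian_polynomial] leaf_frame_def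
          differential_casimir_field[OF that] coeff_fun_polynomial)
    show "v (CP i) - w (CP i) = 0" if "i < g" for i
      using a[OF that] that by (simp add: w_def leaf_frame_sum_CP) (simp add: c_def)
    show "v (CR i) - w (CR i) = 0" if "i < g" for i
      using b[OF that] that by (simp add: w_def leaf_frame_sum_CR) (simp add: c_def mult.commute[of 2])
  qed
  then have "v = w" by (simp add: fun_eq_iff)
  then show thesis using that by (simp add: w_def)
qed

lemma leaf_dimension:
  assumes x: "x \<in> affine_space (coords g)"
  shows "has_complex_dimension (leaf x) (2 * g)"
  unfolding has_complex_dimension_def
proof
  fix y assume y: "y \<in> leaf x"
  note ind = cfun_independent_family[where B = "leaf_frame y", OF leaf_frame_independent]
  show "cfun.dim (tangent_vectors (leaf x) y) = 2 * g"
  \<comment> \<open>The set of velocities is not shown to be a subspace; it suffices that it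
    contains the frame and lies in its span.\<close>
  proof (rule cfun.dim_unique)
    show "leaf_frame y ` {..<2 * g} \<subseteq> tangent_vectors (leaf x) y"
      using leaf_frame_tangent[OF x y] by blast
    show "tangent_vectors (leaf x) y \<subseteq> cfun.span (leaf_frame y ` {..<2 * g})"
    proof
      fix v assume v: "v \<in> tangent_vectors (leaf x) y"
      have ker: "differential (hamiltonian g n) y v = 0" if "g \<le> n" for n
        using tangent_vectors_casimir[OF lax_skew[OF lax] hamiltonian_polynomial
            hamiltonian_casimir[OF lax that] v] .
      have "v \<in> affine_space (coords g)"
        using tangent_vectors_affine[OF lax_skew[OF lax] x v] .
      from casimir_kernel_span[OF this ker] obtain c
        where c: "v = (\<lambda>i. \<Sum>m<2 * g. c m * leaf_frame y m i)" by blast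
      then have "v = (\<Sum>m<2 * g. cscale (c m) (leaf_frame y m))"
        by (simp add: fun_eq_iff sum_fun_apply cscale_def)
      also have "\<dots> \<in> cfun.span (leaf_frame y ` {..<2 * g})"
        by (intro cfun.span_sum cfun.span_scale cfun.span_base) auto
      finally show "v \<in> cfun.span (leaf_frame y ` {..<2 * g})" .
    qed
    show "cfun.independent (leaf_frame y ` {..<2 * g})" by (rule ind)
    show "card (leaf_frame y ` {..<2 * g}) = 2 * g"
      by (subst card_image) (auto intro: ind)
  qed
qed

end

section \<open>Functional independence\<close>

lemma bezout_no_common_root:
  fixes p q :: "complex poly"
  assumes "p \<noteq> 0" "\<And>z. poly p z = 0 \<Longrightarrow> poly q z \<noteq> 0"
  obtains u v where "u * p + v * q = 1"
proof -
  let ?d = "gcd p q"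
  have "degree ?d = 0"
  proof (rule ccontr)
    assume "degree ?d \<noteq> 0"
    then obtain z where "poly ?d z = 0"
      using alg_closed_imp_poly_has_root[of ?d] by auto
    then have "[:- z, 1:] dvd ?d"
      by (simp only: poly_eq_0_iff_dvd)
    then have "poly p z = 0 \<and> poly q z = 0"
      unfolding poly_eq_0_iff_dvd by (blast intro: dvd_trans)
    then show False using assms(2) by blast
  qed
  moreover have "?d \<noteq> 0" using assms(1) by simp
  ultimately obtain c where c: "?d = [:c:]" "c \<noteq> 0"
    by (metis degree_eq_zeroE pCons_0_0)
  obtain u v where "u * p + v * q = [:c:]"
    using bezout_coefficients_fst_snd[of p q] unfolding c(1) by blast
  then have "smult (1 / c) u * p + smult (1 / c) v * q = smult (1 / c) [:c:]"
    by (metis mult_smult_left smult_add_right)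
  then show thesis
    by (intro that[of "smult (1 / c) u" "smult (1 / c) v"]) (simp add: c(2) one_pCons)
qed

text \<open>The cofactor of \<open>p\<close> is reduced modulo \<open>r\<close>, and comparing
  degrees then bounds the other cofactor. With these bounds \<open>a / 2\<close> and
  \<open>b\<close> are admissible variations of P and Q.\<close>

lemma monom_combination:
  fixes p r :: "complex poly"
  assumes "degree p = Suc g" "degree r = g" "g > 0" "j \<le> 2 * g"
    and "\<And>z. poly r z = 0 \<Longrightarrow> poly p z \<noteq> 0"
  obtains a b where "a * p + b * r = monom 1 j" "degree a < g" "degree b \<le> g"
proof -
  have r: "r \<noteq> 0" using assms(2,3) by auto
  obtain u v where uv: "u * r + v * p = 1"
    using bezout_no_common_root[OF r assms(5)] by metis
  define a where "a = (monom 1 j * v) mod r"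
  define b where "b = monom 1 j * u + (monom 1 j * v) div r * p"
  have v: "monom 1 j * v = (monom 1 j * v) div r * r + a"
    by (simp add: a_def)
  have "monom 1 j = monom 1 j * u * r + (monom 1 j * v) * p"
    by (metis uv distrib_left mult.assoc mult.right_neutral)
  also have "\<dots> = a * p + b * r"
    by (subst v) (simp add: b_def algebra_simps)
  finally have ab: "a * p + b * r = monom 1 j" by simp
  have a: "degree a < g"
    using degree_mod_less[OF r, of "monom 1 j * v"] assms(2,3) by (auto simp: a_def)
  have "degree (b * r) \<le> 2 * g"
  proof -
    have "b * r = monom 1 j - a * p"
      using ab by (simp add: algebra_simps)
    moreover have "degree (a * p) \<le> 2 * g"
      using degree_mult_le[of a p] a assms(1) by simp
    moreover have "degree (monom (1::complex) j) \<le> 2 * g"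
      using assms(4) by (simp add: degree_monom_eq)
    ultimately show ?thesis by (simp add: degree_diff_le)
  qed
  then have "degree b \<le> g"
    using r assms(2) by (cases "b = 0") (simp_all add: degree_mult_eq)
  then show thesis using that ab a by blast
qed

text \<open>Passing to homogeneous coordinates \<open>(a, b)\<close> makes the set of possible common roots compact.\<close>

lemma open_no_common_root:
  "open {y. \<forall>z. poly (R_poly g y) z = 0 \<longrightarrow> poly (P_poly g y) z \<noteq> 0}"
proof -
  define K where "K = sphere (0 :: complex \<times> complex) 1"
  define R where "R w y = (\<Sum>i\<le>g. R_coeff g i y * fst w ^ i * snd w ^ (g - i))" for w :: "complex \<times> complex" and y
  define P where "P w y = (\<Sum>i\<le>Suc g. P_coeff g i y * fst w ^ i * snd w ^ (Suc g - i))" for w :: "complex \<times> complex" and y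
  define T where "T = {p. R (fst p) (snd p) = 0 \<and> P (fst p) (snd p) = 0}"
  have cont: "continuous_on UNIV (\<lambda>p :: (complex \<times> complex) \<times> (coord \<Rightarrow> complex). f (snd p))"
    if "f \<in> polynomial_functions I" for f and I :: "coord set"
    using that
  proof induction
    case (coord i)
    show ?case
      by (intro continuous_on_compose2[OF continuous_on_product_coordinates continuous_on_snd]) auto
  qed (auto intro!: continuous_intros)
  have "closed T"
    unfolding T_def R_def P_def
    by (intro closed_Collect_conj closed_Collect_eq continuous_intros cont[OF coeff_fun_polynomial(1)]
        cont[OF coeff_fun_polynomial(3)])
  then have "closedin (prod_topology (top_of_set K) (top_of_set UNIV)) (T \<inter> (K \<times> UNIV))"
    by (simp only: prod_topology_subtopology_eu) (metis closedin_closed Int_commute)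
  \<comment> \<open>Projection along the compact sphere is closed, so the bad points, which are the
    image of a closed set, form a closed set.\<close>
  moreover have "closed_map (prod_topology (top_of_set K) (top_of_set (UNIV :: (coord \<Rightarrow> complex) set)))
      (top_of_set UNIV) snd"
    by (rule Abstract_Topological_Spaces.closed_map_snd) (simp add: K_def compact_space_subtopology)
  ultimately have "closed (snd ` (T \<inter> (K \<times> UNIV)))"
    unfolding closed_map_def by auto
  moreover have "snd ` (T \<inter> (K \<times> UNIV)) =
      {y. \<exists>z. poly (R_poly g y) z = 0 \<and> poly (P_poly g y) z = 0}" (is "?L = ?R")
  proof (intro equalityI subsetI)
    fix y assume "y \<in> ?L"
    then obtain a b where ab: "(a, b) \<in> K" "R (a, b) y = 0" "P (a, b) y = 0"
      by (auto simp: T_def)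
    \<comment> \<open>As R is monic, its homogenization at \<open>b = 0\<close> is
      \<open>a ^ g\<close>, so no common zero lies at infinity.\<close>
    have b: "b \<noteq> 0"
    proof
      assume "b = 0"
      then have "R (a, b) y = (\<Sum>i\<le>g. if i = g then a ^ g else 0)"
        unfolding R_def by (intro sum.cong refl) (auto simp: const_coeff)
      then have "a = 0" using ab(2) by simp
      with \<open>b = 0\<close> ab(1) show False by (simp add: K_def)
    qed
    have "R (a, b) y = b ^ g * poly (R_poly g y) (a / b)"
      using b unfolding R_def
      by (subst poly_eq_sum_bound[of _ g])
        (auto simp: degree_poly sum_distrib_left R_coeff_def power_divide power_diff field_simps intro!: sum.cong)
    moreover have "P (a, b) y = b ^ Suc g * poly (P_poly g y) (a / b)"
      using b unfolding P_def
      by (subst poly_eq_sum_bound[of _ "Suc g"])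
        (auto simp: degree_poly sum_distrib_left P_coeff_def power_divide power_diff field_simps
          simp del: power_Suc sum.atMost_Suc intro!: sum.cong)
    ultimately show "y \<in> ?R"
      using ab b by auto
  next
    fix y assume "y \<in> ?R"
    then obtain z where z: "poly (R_poly g y) z = 0" "poly (P_poly g y) z = 0" by blast
    define n where "n = norm (z, 1 :: complex)"
    have n: "n > 0" by (simp add: n_def zero_prod_def)
    define b where "b = complex_of_real (1 / n)"
    have "R (b * z, b) y = b ^ g * poly (R_poly g y) z"
      unfolding R_def
      by (subst poly_eq_sum_bound[of _ g])
        (auto simp: degree_poly sum_distrib_left R_coeff_def power_mult_distrib mult_ac
          power_add[symmetric] intro!: sum.cong)
    moreover have "P (b * z, b) y = b ^ Suc g * poly (P_poly g y) z"
      unfolding P_def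
      by (subst poly_eq_sum_bound[of _ "Suc g"])
        (auto simp: degree_poly sum_distrib_left P_coeff_def power_mult_distrib mult_ac
          power_add[symmetric] simp del: power_Suc sum.atMost_Suc intro!: sum.cong)
    moreover have "(b * z, b) \<in> K"
    proof -
      have "(b * z, b) = (1 / n) *\<^sub>R (z, 1)"
        by (simp add: b_def scaleR_conv_of_real)
      then have "norm (b * z, b) = (1 / n) * n"
        using n by (simp only: norm_scaleR n_def[symmetric]) simp
      then show ?thesis using n by (simp add: K_def)
    qed
    ultimately show "y \<in> ?L"
      using z by (auto simp: T_def intro!: image_eqI[of _ snd "((b * z, b), y)"])
  qed
  ultimately have "open (- {y. \<exists>z. poly (R_poly g y) z = 0 \<and> poly (P_poly g y) z = 0})"
    by (simp add: closed_def)
  then show ?thesis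
    by (simp add: Compl_eq)
qed

context
  fixes g :: nat and br :: "coord bracket"
  assumes lax: "lax_bracket g br"
begin

text \<open>A solution of a P + b R = \<zeta>^j gives the direction dP = a / 2, dQ = b, dR = 0,
  along which dF = 2 P dP + Q dR + R dQ equals \<zeta>^j. This direction is dual to c_j, and as
  \<open>j < g\<close> the differentials of all Casimir functions c_n vanish on it.\<close>

lemma independent_differentials:
  assumes "g > 0" and x: "x \<in> affine_space (coords g)" and y: "y \<in> leaf g br x"
    and coprime: "\<And>z. poly (R_poly g y) z = 0 \<Longrightarrow> poly (P_poly g y) z \<noteq> 0"
    and zero: "\<And>v. v \<in> tangent_vectors (leaf g br x) y \<Longrightarrow>
      (\<Sum>i<g. c i * differential (hamiltonian g i) y v) = 0"
    and j: "j < g"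
  shows "c j = 0"
proof -
  obtain a b where ab: "a * P_poly g y + b * R_poly g y = monom 1 j" "degree a < g" "degree b \<le> g"
    using monom_combination[OF degree_poly(1) degree_poly(3) assms(1) _ coprime, of j] j by auto
  define v where "v d = (case d of
      CP i \<Rightarrow> coeff (smult (1 / 2) a) i | CQ i \<Rightarrow> coeff b i | CR i \<Rightarrow> 0)" for d
  have v_poly: "dP_poly g v = smult (1 / 2) a" "dR_poly g v = 0" "Q_poly g v = b"
    using ab(2,3) by (auto simp: poly_eq_iff coeff_dP_poly coeff_dR_poly coeff_Q_poly v_def coeff_eq_0)
  have diff: "differential (hamiltonian g n) y v = (if n = j then 1 else 0)" for n
  proof -
    have "2 * P_poly g y * smult (1 / 2) a + R_poly g y * b = a * P_poly g y + b * R_poly g y"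
      by (simp add: numeral_poly mult.commute)
    then show ?thesis
      by (simp add: differential_hamiltonian v_poly ab(1))
  qed
  have "v d = 0" if "d \<notin> coords g" for d
  proof (cases d)
    case (CP i)
    then have "degree a < i" using that ab(2) by (simp add: coords_def image_iff)
    then show ?thesis by (simp add: CP v_def coeff_eq_0)
  next
    case (CQ i)
    then have "degree b < i" using that ab(3) by (simp add: coords_def image_iff)
    then show ?thesis by (simp add: CQ v_def coeff_eq_0)
  qed (simp add: v_def)
  then have "v \<in> affine_space (coords g)"
    by (simp add: affine_space_def)
  moreover have "differential (hamiltonian g n) y v = 0" if "g \<le> n" for n
    using that j by (simp add: diff)
  \<comment> \<open>The hypothesis \<open>zero\<close> speaks of velocities of curves only;
    expanding \<open>v\<close> in the frame transfers it to \<open>v\<close> by linearity.\<close>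
  ultimately obtain d where d: "v = (\<lambda>i. \<Sum>m<2 * g. d m * leaf_frame g br y m i)"
    by (rule casimir_kernel_span[OF lax])
  have "c j = (\<Sum>i<g. c i * differential (hamiltonian g i) y v)"
    using j by (simp add: diff if_distrib[of "\<lambda>t. _ * t"] cong: if_cong)
  also have "\<dots> = (\<Sum>i<g. \<Sum>m<2 * g. d m * (c i * differential (hamiltonian g i) y (leaf_frame g br y m)))"
    unfolding d
    by (simp add: differential_lincomb[OF hamiltonian_polynomial] sum_distrib_left mult.left_commute)
  also have "\<dots> = (\<Sum>m<2 * g. d m * (\<Sum>i<g. c i * differential (hamiltonian g i) y (leaf_frame g br y m)))"
    by (subst sum.swap) (simp add: sum_distrib_left)
  also have "\<dots> = 0"
    using zero[OF leaf_frame_tangent[OF lax x y]] by simp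
  finally show ?thesis .
qed

lemma leaf_generic_dense:
  assumes "g > 0" and x: "x \<in> affine_space (coords g)" and y: "y \<in> leaf g br x"
  shows "y \<in> closure {y \<in> leaf g br x. \<forall>z. poly (R_poly g y) z = 0 \<longrightarrow> poly (P_poly g y) z \<noteq> 0}"
    (is "y \<in> closure ?W")
proof -
  define \<gamma> where "\<gamma> = R_flow g (g - 1) y"
  have y': "y \<in> affine_space (coords g)"
    using symplectic_leaf_affine[OF lax_skew[OF lax] x y] .
  have R: "R_poly g (\<gamma> t) = R_poly g y" for t
    using R_flow_coeff(2)[of g _ "g - 1" y t] by (simp add: poly_eq_iff \<gamma>_def R_coeff_def)
  \<comment> \<open>The flow subtracts 2 t times \<open>R_coeff g (i + g)\<close>, which is 1 for
    \<open>i = 0\<close> and 0 otherwise, so only the constant term of P changes.\<close>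
  have P: "P_poly g (\<gamma> t) = P_poly g y - [:2 * of_real t:]" for t
    using R_flow_coeff(1)[of g _ "g - 1" y t] assms(1)
    by (auto simp: poly_eq_iff \<gamma>_def P_coeff_def coeff_fun_simps(3) coeff_pCons split: nat.split)
  \<comment> \<open>The bad times: each satisfies 2 t = P(z) for one of the finitely many roots z of
    R.\<close>
  define F where "F = {t :: real. \<exists>z. poly (R_poly g y) z = 0 \<and> poly (P_poly g y) z = 2 * of_real t}"
  have "R_poly g y \<noteq> 0"
    using coeff_R_poly[of g y g] by auto
  then have "finite {z. poly (R_poly g y) z = 0}"
    by (rule poly_roots_finite)
  then have "finite ((\<lambda>z. Re (poly (P_poly g y) z) / 2) ` {z. poly (R_poly g y) z = 0})"
    by simp
  moreover have "F \<subseteq> (\<lambda>z. Re (poly (P_poly g y) z) / 2) ` {z. poly (R_poly g y) z = 0}"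
    by (auto simp: F_def image_iff) (metis Re_complex_of_real mult.commute nonzero_mult_div_cancel_right of_real_mult of_real_numeral zero_neq_numeral)
  ultimately have "finite F" by (rule rev_finite_subset)
  \<comment> \<open>The point \<open>y\<close> may itself be bad, so 0 may belong to
    \<open>F\<close>; only a punctured neighbourhood of 0 has to avoid \<open>F\<close>.\<close>
  then have "open (- (F - {0}))"
    by (intro open_Compl finite_imp_closed finite_Diff)
  then have "eventually (\<lambda>t. t \<in> - (F - {0})) (at 0)"
    by (intro eventually_at_topological[THEN iffD2] exI[of _ "- (F - {0})"]) auto
  then have "eventually (\<lambda>t. t \<notin> F) (at 0)"
    using eventually_neq_at_within[of 0 0 UNIV] by eventually_elim auto
  moreover have "\<gamma> t \<in> ?W" if "t \<notin> F" for t
  proof -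
    have "\<gamma> t \<in> leaf g br x"
      unfolding \<gamma>_def by (rule R_flow_in_leaf[OF lax x y])
    then show ?thesis using that by (auto simp: F_def R P)
  qed
  ultimately have "eventually (\<lambda>t. \<gamma> t \<in> closure ?W) (at 0)"
    using closure_subset[of ?W] by (auto elim!: eventually_mono)
  moreover have "(\<gamma> \<longlongrightarrow> \<gamma> 0) (at 0)"
  proof -
    have "continuous_on UNIV \<gamma>"
      using R_flow_deriv[OF lax] unfolding \<gamma>_def
      by (intro continuous_on_coordinatewise_then_product continuous_at_imp_continuous_on)
        (blast intro: has_vector_derivative_continuous)
    then show ?thesis
      by (simp add: continuous_on_def)
  qed
  ultimately have "\<gamma> 0 \<in> closure ?W"
    by (intro Lim_in_closed_set[OF closed_closure]) auto
  then show ?thesis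
    by (simp add: \<gamma>_def R_flow_0[OF y'])
qed

lemma leaf_functionally_independent:
  assumes "g > 0" and x: "x \<in> affine_space (coords g)"
  shows "functionally_independent_on (leaf g br x) g (hamiltonian g)"
proof -
  let ?W = "{y \<in> leaf g br x. \<forall>z. poly (R_poly g y) z = 0 \<longrightarrow> poly (P_poly g y) z \<noteq> 0}"
  have "?W = leaf g br x \<inter> {y. \<forall>z. poly (R_poly g y) z = 0 \<longrightarrow> poly (P_poly g y) z \<noteq> 0}"
    by blast
  then have "openin (top_of_set (leaf g br x)) ?W"
    using open_no_common_root[of g] by (simp only: openin_open_Int)
  moreover have "leaf g br x \<subseteq> closure ?W"
    using leaf_generic_dense[OF assms] by blast
  ultimately show ?thesis
    unfolding functionally_independent_on_def
    using independent_differentials[OF assms] by (intro exI[of _ ?W]) blast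
qed

end

theorem theorem6p1:
  fixes g :: nat
  assumes "g \<ge> 1"
  shows "(\<exists>br. lax_bracket g br) \<and>
         (\<forall>br. lax_bracket g br \<longrightarrow> completely_integrable (coords g) br g (hamiltonian g))"
proof (intro conjI allI impI)
  show "\<exists>br. lax_bracket g br"
    using lax_bracket_tensor by blast
next
  fix br assume lax: "lax_bracket g br"
  have "\<exists>U. openin (top_of_set (affine_space (coords g))) U \<and> affine_space (coords g) \<subseteq> closure U \<and>
        (\<forall>x \<in> U. has_complex_dimension (leaf g br x) (2 * g) \<and>
                 functionally_independent_on (leaf g br x) g (hamiltonian g))"
    using assms leaf_dimension[OF lax] leaf_functionally_independent[OF lax]
    by (intro exI[of _ "affine_space (coords g)"]) (auto intro: closure_subset[THEN subsetD])
  then show "completely_integrable (coords g) br g (hamiltonian g)"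
    unfolding completely_integrable_def
    using lax_poisson_bracket[OF lax] hamiltonian_polynomial hamiltonian_involution[OF lax] by blast
qed

end
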